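(* There exist absolute constants $C, C_3 > 0$ such that the following holds. Let $r \ge 2$ be an integer and let $N$ be a positive integer with $N \ge C_3^r$. For $j \in [N]$ let $\sigma_j := \sigma_j(D^r)$ be the $j$-th singular value of $D^r$, with associated left and right ($\ell^2$-normalized) singular vectors $\mathbf{u}_j, \mathbf{v}_j \in \mathbb{R}^N$. Then $$\max_{j \in [N]} \left\{ \|\mathbf{u}_j\|_\infty, \|\mathbf{v}_j\|_\infty \right\} \le \frac{(Cr)^{6r}}{\sqrt{N}}.$$
   Context: $[N] = \{1,\dots,N\}$. $D \in \mathbb{R}^{N\times N}$ is the difference matrix with entries $D_{i,j} = 1$ if $i=j$, $D_{i,j} = -1$ if $i = j+1$, and $D_{i,j}=0$ otherwise; $D^r$ is its $r$-th matrix power. Singular values are ordered $\sigma_1 \ge \sigma_2 \ge \dots \ge \sigma_N \geq 0$. In a singular value decomposition $D^r = U\Sigma V^*$, with $U,V$ having orthonormal columns, $\mathbf{u}_j$ and $\mathbf{v}_j$ denote the $j$-th columns of $U$ and $V$. "Absolute" means independent of $N$, $r$ and $j$. *)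

theory Defs
  imports Complex_Main "Jordan_Normal_Form.Matrix"
begin

text \<open>Indices run over \<open>0, \<dots>, N - 1\<close> instead of \<open>1, \<dots>, N\<close>.\<close>

definition diff_mat :: "nat \<Rightarrow> real mat" where
  "diff_mat N = mat N N (\<lambda>(i, j). if i = j then 1 else if i = j + 1 then - 1 else 0)"

text \<open>Singular value decomposition \<open>A = U \<Sigma> V\<^sup>T\<close> of a real \<open>n \<times> n\<close> matrix. The
  \<open>j\<close>-th diagonal entry of \<open>S\<close> is the singular value \<open>\<sigma>\<^sub>j(A)\<close>; the \<open>j\<close>-th columns of
  \<open>U\<close> and \<open>V\<close> are the associated left and right singular vectors.
  The library's \<open>orthogonal_mat\<close> asks only for pairwise orthogonal nonzero columns,
  so the normalization of the columns is expressed through \<open>U\<^sup>T U = V\<^sup>T V = 1\<close>.\<close>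

definition is_svd :: "nat \<Rightarrow> real mat \<Rightarrow> real mat \<Rightarrow> real mat \<Rightarrow> real mat \<Rightarrow> bool" where
  "is_svd n A U S V \<longleftrightarrow>
     A \<in> carrier_mat n n \<and> U \<in> carrier_mat n n \<and> S \<in> carrier_mat n n \<and> V \<in> carrier_mat n n \<and>
     transpose_mat U * U = 1\<^sub>m n \<and> transpose_mat V * V = 1\<^sub>m n \<and>
     diagonal_mat S \<and>
     (\<forall>j<n. 0 \<le> S $$ (j, j)) \<and>
     (\<forall>i j. i \<le> j \<longrightarrow> j < n \<longrightarrow> S $$ (j, j) \<le> S $$ (i, i)) \<and>
     A = U * S * transpose_mat V"

text \<open>The element \<open>0\<close> only matters for the vector of dimension \<open>0\<close>.\<close>

definition sup_norm_vec :: "real vec \<Rightarrow> real" where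
  "sup_norm_vec v = Max (insert 0 ((\<lambda>i. \<bar>v $ i\<bar>) ` {..<dim_vec v}))"

end

theory Submission
  imports Defs "HOL-Analysis.L2_Norm" "HOL-Computational_Algebra.Fundamental_Theorem_Algebra"
begin

text \<open>
  Let \<open>D\<^sup>r v = \<sigma> u\<close> and \<open>(D\<^sup>T)\<^sup>r u = \<sigma> v\<close>, and let \<open>c\<close> be the \<open>r\<close>-th root of \<open>\<sigma>\<close>. Away from
  the ends of the index range both sequences solve the recurrence \<open>(2 - E - E\<^sup>-\<^sup>1)\<^sup>r = c\<^sup>2\<^sup>r\<close>, where
  \<open>E\<close> is the shift. Hence they are sums of \<open>2 r\<close> modes \<open>z\<^sup>-\<^sup>n\<close>, where \<open>z\<close> runs through the roots
  of \<open>(2 - z - 1/z)\<^sup>r = c\<^sup>2\<^sup>r\<close>. The two roots with \<open>2 - z - 1/z = c\<^sup>2\<close> lie on the unit circle and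
  oscillate; the other modes may grow or decay. What has to be shown is that neither kind of mode
  concentrates near an end.

  Cut the sequences at position \<open>n\<close>. The generating polynomials of the first \<open>n\<close> entries satisfy
  \<open>(1 - z)\<^sup>r V\<^sub>n - c\<^sup>r U\<^sub>n = z\<^sup>n p\<^sub>n\<close> with \<open>p\<^sub>n\<close> of degree less than \<open>r\<close>, the \<^emph>\<open>overflow\<close> past the
  cut. Cutting from the right gives a second overflow. At a root \<open>z\<close> a combination of the two, called
  the \<^emph>\<open>state\<close> below, is the amplitude of the mode \<open>z\<close> at position \<open>n\<close>: \<open>z\<^sup>n\<close> times the state does
  not depend on \<open>n\<close> (\<open>state_conserved\<close>). So the product of the states at \<open>z\<close> and at \<open>1/z\<close> is
  constant in \<open>n\<close>, and at \<open>n = N\<close> it is \<open>c\<^sup>2\<^sup>r p\<^sub>N(z) p\<^sub>N(1/z)\<close>. Averaging over all \<open>n\<close> and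
  using the Cauchy-Schwarz inequality bounds this by \<open>1/N\<close> times squared \<open>\<ell>\<^sup>2\<close> norms in \<open>n\<close> of the
  state. For real \<open>x\<close> with \<open>1 < x \<le> 1 + c\<close> the values \<open>p\<^sub>n(x)\<close> are convolutions of \<open>v\<close> and \<open>u\<close> with a geometric
  kernel, whose \<open>\<ell>\<^sup>2\<close> norms are at most \<open>2 c\<^sup>r / (x - 1)\<close>; Lagrange interpolation in \<open>r\<close> such points
  carries the estimate to the roots. This is \<open>overflow_product_bound\<close>.

  To separate the factors, write \<open>p\<^sub>N(z) p\<^sub>N(1/z)\<close> as a polynomial \<open>\<kappa>\<close> in \<open>2 - z - 1/z\<close> of degree
  less than \<open>r\<close>. Its values at the \<open>r\<close> numbers \<open>y\<close> with \<open>y\<^sup>r = c\<^sup>2\<^sup>r\<close> have just been bounded, so \<open>\<kappa>\<close>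
  is bounded on \<open>[0, c\<^sup>2]\<close>. There it is \<open>\<bar>p\<^sub>N\<bar>\<^sup>2\<close> on an arc of the unit circle. A last interpolation,
  from this arc to the roots, bounds \<open>p\<^sub>N(z)\<close> itself (\<open>overflow_root_bound\<close>), that is, the amplitude of
  every mode at the right end. Reversal of the indices exchanges \<open>v\<close> and \<open>u\<close> and yields the left end.
  A mode with \<open>\<bar>z\<bar> \<le> 1\<close> is largest at the right end and the others are largest at the left end, so
  the state is bounded at every position (\<open>state_bound\<close>).

  Finally an entry of \<open>u\<close> is, up to sign, the leading coefficient of the polynomial of degree at most
  \<open>2 r - 1\<close> that takes the values \<open>z\<^sup>r\<^sup>-\<^sup>1\<close> times the state at the \<open>2 r\<close> roots. Each root with \<open>2 - z - 1/z \<noteq> c\<^sup>2\<close>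
  contributes \<open>O(1/\<surd>N)\<close>. The two oscillating roots can be arbitrarily close to each other and their
  terms need not be small, but their sum \<open>g\<close> has bounded \<open>\<ell>\<^sup>2\<close> norm, because \<open>u\<close> and the other terms
  have. The relation \<open>g\<^sub>n = (z\<^sup>q + z\<^sup>-\<^sup>q) g\<^sub>n\<^sub>+\<^sub>q - g\<^sub>n\<^sub>+\<^sub>2\<^sub>q\<close>, used for about \<open>N/4\<close> values of \<open>q\<close>, spreads
  this norm evenly over the indices (\<open>oscillation_bound\<close>). The constants that arise
  are products of powers \<open>(a r)\<^sup>r\<close> with numbers \<open>a\<close>; in total they stay below \<open>(20 r)\<^sup>6\<^sup>r\<close>.
\<close>

section \<open>Polynomial interpolation and reciprocal-symmetric products\<close>

lemma lagrange_interpolation: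
  fixes p :: "'a::field poly"
  assumes "finite A" "degree p < card A"
  shows "p = (\<Sum>a\<in>A. smult (poly p a / (\<Prod>b\<in>A-{a}. a - b)) (\<Prod>b\<in>A-{a}. [:-b, 1:]))"
    (is "p = ?L")
proof (rule ccontr)
  assume "p \<noteq> ?L"
  hence ne: "p - ?L \<noteq> 0" by simp
  have degL: "degree ?L < card A"
  proof -
    have "degree (smult (poly p a / (\<Prod>b\<in>A-{a}. a - b)) (\<Prod>b\<in>A-{a}. [:-b, 1:])) \<le> card A - 1"
      if "a \<in> A" for a
    proof -
      have "degree (\<Prod>b\<in>A-{a}. [:-b, 1::'a:]) \<le> (\<Sum>b\<in>A-{a}. degree [:-b, 1::'a:])"
        using degree_prod_sum_le[of "A-{a}" "\<lambda>b. [:-b, 1::'a:]"] assms(1) by (simp add: o_def)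
      also have "\<dots> = card A - 1"
        using assms(1) that by simp
      finally show ?thesis
        using degree_smult_le le_trans by blast
    qed
    hence "degree ?L \<le> card A - 1"
      using assms(1) by (intro degree_sum_le) auto
    thus ?thesis using assms(2) by linarith
  qed
  have "A \<subseteq> {x. poly (p - ?L) x = 0}"
  proof
    fix x assume x: "x \<in> A"
    have "poly ?L x = (\<Sum>a\<in>A. poly p a / (\<Prod>b\<in>A-{a}. a - b) * (\<Prod>b\<in>A-{a}. x - b))"
      by (simp add: poly_sum poly_prod)
    also have "\<dots> = (\<Sum>a\<in>A. if a = x then poly p x else 0)"
    proof (rule sum.cong)
      fix a assume a: "a \<in> A"
      show "poly p a / (\<Prod>b\<in>A-{a}. a - b) * (\<Prod>b\<in>A-{a}. x - b) = (if a = x then poly p x else 0)"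
      proof (cases "a = x")
        case True
        have "(\<Prod>b\<in>A-{a}. a - b) \<noteq> 0" using assms(1) by simp
        thus ?thesis using True by simp
      next
        case False
        have "(\<Prod>b\<in>A-{a}. x - b) = 0" using assms(1) x False by auto
        thus ?thesis using False by simp
      qed
    qed simp
    also have "\<dots> = poly p x" using assms(1) x by simp
    finally show "x \<in> {x. poly (p - ?L) x = 0}" by simp
  qed
  hence "card A \<le> card {x. poly (p - ?L) x = 0}"
    using poly_roots_finite[OF ne] card_mono by blast
  also have "\<dots> \<le> degree (p - ?L)" by (rule card_poly_roots_bound[OF ne])
  also have "\<dots> < card A"
    using assms(2) degL by (simp add: degree_diff_less)
  finally show False by simp
qed

lemma coeff_prod_linear:
  assumes "finite B"
  shows "coeff (\<Prod>b\<in>B. [:-b, 1::'a::field:]) (card B) = 1"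
proof -
  have "degree (\<Prod>b\<in>B. [:-b, 1::'a:]) = card B"
    using assms by (subst degree_prod_eq_sum_degree) auto
  moreover have "lead_coeff (\<Prod>b\<in>B. [:-b, 1::'a:]) = 1"
    by (simp add: lead_coeff_prod)
  ultimately show ?thesis by simp
qed

lemma top_coeff_by_interpolation:
  fixes p :: "'a::field poly"
  assumes "finite A" "degree p < card A"
  shows "coeff p (card A - 1) = (\<Sum>a\<in>A. poly p a / (\<Prod>b\<in>A-{a}. a - b))"
proof -
  have "coeff p (card A - 1) = (\<Sum>a\<in>A. poly p a / (\<Prod>b\<in>A-{a}. a - b) * coeff (\<Prod>b\<in>A-{a}. [:-b, 1:]) (card A - 1))"
    by (subst lagrange_interpolation[OF assms]) (simp add: coeff_sum)
  also have "\<dots> = (\<Sum>a\<in>A. poly p a / (\<Prod>b\<in>A-{a}. a - b))"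
  proof (rule sum.cong)
    fix a assume a: "a \<in> A"
    have "card (A - {a}) = card A - 1" using a assms(1) by simp
    thus "poly p a / (\<Prod>b\<in>A-{a}. a - b) * coeff (\<Prod>b\<in>A-{a}. [:-b, 1:]) (card A - 1)
      = poly p a / (\<Prod>b\<in>A-{a}. a - b)"
      using coeff_prod_linear[of "A - {a}"] assms(1) by simp
  qed simp
  finally show ?thesis .
qed

text \<open>If the nodes are \<open>\<delta>\<close>-separated and \<open>z\<close> is within \<open>K \<delta>\<close> of all of them, then every factor
\<open>\<bar>z - b\<bar> / \<bar>a - b\<bar>\<close> of the Lagrange basis is at most \<open>K\<close>. All later uses have \<open>K\<close> of order
\<open>r\<close> and \<open>r\<close> nodes, which is where the factors \<open>r\<^sup>r\<close> come from.\<close>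

lemma norm_poly_le_by_interpolation:
  fixes p :: "complex poly"
  assumes "finite A" "degree p < card A" "\<delta> > 0"
    and sep: "\<And>a b. a \<in> A \<Longrightarrow> b \<in> A \<Longrightarrow> a \<noteq> b \<Longrightarrow> \<delta> \<le> norm (a - b)"
    and near: "\<And>a. a \<in> A \<Longrightarrow> norm (z - a) \<le> K * \<delta>"
  shows "norm (poly p z) \<le> K ^ (card A - 1) * (\<Sum>a\<in>A. norm (poly p a))"
proof -
  have "poly p z = (\<Sum>a\<in>A. poly p a / (\<Prod>b\<in>A-{a}. a - b) * (\<Prod>b\<in>A-{a}. z - b))"
    by (subst lagrange_interpolation[OF assms(1,2)]) (simp add: poly_sum poly_prod)
  hence "norm (poly p z) \<le> (\<Sum>a\<in>A. norm (poly p a / (\<Prod>b\<in>A-{a}. a - b) * (\<Prod>b\<in>A-{a}. z - b)))"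
    by (simp only: norm_sum)
  also have "\<dots> \<le> (\<Sum>a\<in>A. K ^ (card A - 1) * norm (poly p a))"
  proof (rule sum_mono)
    fix a assume a: "a \<in> A"
    have "norm ((\<Prod>b\<in>A-{a}. z - b) / (\<Prod>b\<in>A-{a}. a - b)) = (\<Prod>b\<in>A-{a}. norm (z - b) / norm (a - b))"
      by (simp add: norm_divide prod_norm prod_dividef)
    also have "\<dots> \<le> (\<Prod>b\<in>A-{a}. K)"
    proof (rule prod_mono, safe)
      fix b assume b: "b \<in> A" "b \<noteq> a"
      have s: "\<delta> \<le> norm (a - b)" using sep a b by blast
      have "0 \<le> K * \<delta>" using order_trans[OF norm_ge_zero near[OF b(1)]] .
      hence K: "0 \<le> K" using \<open>\<delta> > 0\<close> by (simp add: zero_le_mult_iff)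
      have "norm (z - b) \<le> K * norm (a - b)"
        using near[OF b(1)] mult_left_mono[OF s K] by (rule order_trans)
      thus "norm (z - b) / norm (a - b) \<le> K"
        using s K \<open>\<delta> > 0\<close> by (simp add: divide_le_eq)
    qed simp
    also have "\<dots> = K ^ (card A - 1)" using a assms(1) by simp
    finally have *: "norm ((\<Prod>b\<in>A-{a}. z - b) / (\<Prod>b\<in>A-{a}. a - b)) \<le> K ^ (card A - 1)" .
    have "norm (poly p a / (\<Prod>b\<in>A-{a}. a - b) * (\<Prod>b\<in>A-{a}. z - b))
      = norm ((\<Prod>b\<in>A-{a}. z - b) / (\<Prod>b\<in>A-{a}. a - b)) * norm (poly p a)"
      unfolding norm_mult[symmetric] by (rule arg_cong[of _ _ norm]) simp
    also have "\<dots> \<le> K ^ (card A - 1) * norm (poly p a)"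
      by (rule mult_right_mono[OF *]) simp
    finally show "norm (poly p a / (\<Prod>b\<in>A-{a}. a - b) * (\<Prod>b\<in>A-{a}. z - b)) \<le> K ^ (card A - 1) * norm (poly p a)" .
  qed
  finally show ?thesis by (simp add: sum_distrib_left)
qed

text \<open>The Chebyshev recursion \<open>t\<^sub>k\<^sub>+\<^sub>2 = (2 - y) t\<^sub>k\<^sub>+\<^sub>1 - t\<^sub>k\<close> in the variable \<open>y = 2 - z - 1/z\<close>.\<close>

lemma exists_power_sum_poly:
  "\<exists>\<tau> :: complex poly. degree \<tau> \<le> k \<and> (\<forall>z. z \<noteq> 0 \<longrightarrow> z ^ k + (1 / z) ^ k = poly \<tau> (2 - z - 1 / z))"
proof (induction k rule: less_induct)
  case (less k)
  consider "k = 0" | "k = 1" | m where "k = Suc (Suc m)"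
    by (metis One_nat_def not0_implies_Suc)
  thus ?case
  proof cases
    case 1
    thus ?thesis by (intro exI[of _ "[:2:]"]) simp
  next
    case 2
    thus ?thesis by (intro exI[of _ "[:2, -1:]"]) simp
  next
    case 3
    obtain \<tau>0 :: "complex poly" where t0: "degree \<tau>0 \<le> m"
      "\<And>z. z \<noteq> 0 \<Longrightarrow> z ^ m + (1 / z) ^ m = poly \<tau>0 (2 - z - 1 / z)"
      using less[of m] 3 by auto
    obtain \<tau>1 :: "complex poly" where t1: "degree \<tau>1 \<le> Suc m"
      "\<And>z. z \<noteq> 0 \<Longrightarrow> z ^ Suc m + (1 / z) ^ Suc m = poly \<tau>1 (2 - z - 1 / z)"
      using less[of "Suc m"] 3 by auto
    let ?t = "[:2, -1:] * \<tau>1 - \<tau>0"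
    have "degree ([:2, -1:] * \<tau>1) \<le> k"
      using degree_mult_le[of "[:2, -1:]" \<tau>1] t1(1) 3 by simp
    hence "degree ?t \<le> k" using t0(1) 3 by (intro degree_diff_le) auto
    moreover have "z ^ k + (1 / z) ^ k = poly ?t (2 - z - 1 / z)" if "z \<noteq> 0" for z
    proof -
      have "poly ?t (2 - z - 1 / z) = (z + 1 / z) * (z ^ Suc m + (1 / z) ^ Suc m) - (z ^ m + (1 / z) ^ m)"
        using t0(2)[OF that] t1(2)[OF that] by (simp add: algebra_simps)
      also have "\<dots> = z ^ k + (1 / z) ^ k"
        using that 3 by (simp add: field_simps)
      finally show ?thesis by simp
    qed
    ultimately show ?thesis by blast
  qed
qed

lemma exists_symmetrization_poly:
  fixes q :: "complex poly"
  assumes "degree q \<le> d"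
  shows "\<exists>\<tau>. degree \<tau> \<le> d \<and> (\<forall>z. z \<noteq> 0 \<longrightarrow> poly q z + poly q (1 / z) = poly \<tau> (2 - z - 1 / z))"
proof -
  obtain \<tau> :: "nat \<Rightarrow> complex poly" where t: "\<And>k. degree (\<tau> k) \<le> k"
    "\<And>k z. z \<noteq> 0 \<Longrightarrow> z ^ k + (1 / z) ^ k = poly (\<tau> k) (2 - z - 1 / z)"
    using exists_power_sum_poly by metis
  let ?t = "\<Sum>k\<le>d. smult (coeff q k) (\<tau> k)"
  have "degree ?t \<le> d"
    by (intro degree_sum_le) (use t(1) degree_smult_le order_trans in \<open>auto, blast\<close>)
  moreover have "poly q z + poly q (1 / z) = poly ?t (2 - z - 1 / z)" if "z \<noteq> 0" for z
  proof -
    have q: "poly q x = (\<Sum>k\<le>d. coeff q k * x ^ k)" for x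
    proof -
      have "poly q x = poly (\<Sum>k\<le>d. monom (coeff q k) k) x"
        using poly_as_sum_of_monoms'[OF assms] by simp
      thus ?thesis by (simp add: poly_sum poly_monom)
    qed
    show ?thesis
      by (simp add: q poly_sum t(2)[OF that, symmetric] sum.distrib ring_distribs)
  qed
  ultimately show ?thesis by blast
qed

text \<open>On the unit circle, and for real coefficients, the left-hand side is \<open>\<bar>p(z)\<bar>\<^sup>2\<close> and \<open>2 - z - 1/z\<close> is
\<open>\<bar>1 - z\<bar>\<^sup>2\<close>. The lemma thus continues \<open>\<bar>p\<bar>\<^sup>2\<close> from the circle to the roots of the recurrence,
at the cost of a product of two values of \<open>p\<close>.\<close>

lemma exists_modulus_poly:
  fixes p :: "complex poly"
  shows "\<exists>\<kappa>. degree \<kappa> \<le> degree p \<and> (\<forall>z. z \<noteq> 0 \<longrightarrow> poly p z * poly p (1 / z) = poly \<kappa> (2 - z - 1 / z))"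
proof (induction p rule: pCons_induct)
  case 0
  show ?case by (intro exI[of _ 0]) simp
next
  case (pCons a q)
  show ?case
  proof (cases "q = 0")
    case True
    thus ?thesis by (intro exI[of _ "[:a * a:]"]) simp
  next
    case False
    let ?d = "Suc (degree q)"
    obtain \<kappa> where k: "degree \<kappa> \<le> degree q"
      "\<And>z. z \<noteq> 0 \<Longrightarrow> poly q z * poly q (1 / z) = poly \<kappa> (2 - z - 1 / z)"
      using pCons.IH by blast
    obtain \<tau> where t: "degree \<tau> \<le> ?d"
      "\<And>z. z \<noteq> 0 \<Longrightarrow> poly (pCons 0 q) z + poly (pCons 0 q) (1 / z) = poly \<tau> (2 - z - 1 / z)"
      using exists_symmetrization_poly[of "pCons 0 q" ?d] degree_pCons_le[of 0 q] by blast
    let ?k = "[:a * a:] + \<kappa> + smult a \<tau>"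
    have "degree ?k \<le> ?d"
      using k(1) t(1) degree_smult_le[of a \<tau>] by (intro degree_add_le) auto
    moreover have "poly (pCons a q) z * poly (pCons a q) (1 / z) = poly ?k (2 - z - 1 / z)"
      if "z \<noteq> 0" for z
    proof -
      have "poly ?k (2 - z - 1 / z) = a * a + poly q z * poly q (1 / z)
          + a * (poly (pCons 0 q) z + poly (pCons 0 q) (1 / z))"
        using k(2)[OF that] t(2)[OF that] by simp
      also have "\<dots> = poly (pCons a q) z * poly (pCons a q) (1 / z)"
      proof -
        have "(a + z * P) * (a + P' / z) = a * a + P * P' + a * (z * P + P' / z)" for P P'
          using that by (simp add: ring_distribs add_divide_distrib)
        thus ?thesis by simp
      qed
      finally show ?thesis by simp
    qed
    ultimately show ?thesis using False by (intro exI[of _ ?k]) simp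
  qed
qed

section \<open>The roots of the recurrence\<close>

definition char_roots :: "nat \<Rightarrow> real \<Rightarrow> complex set" where
  "char_roots r c = {z. z \<noteq> 0 \<and> (2 - z - 1 / z) ^ r = of_real (c ^ (2 * r))}"

text \<open>Up to the factor \<open>(-z)\<^sup>r\<close> this is \<open>(2 - z - 1/z)\<^sup>r - c\<^sup>2\<^sup>r\<close>, because \<open>(2 - z - 1/z) z = -(1 - z)\<^sup>2\<close>.\<close>

definition char_root_poly :: "nat \<Rightarrow> real \<Rightarrow> complex poly" where
  "char_root_poly r c = [:1, -1:] ^ (2 * r) - monom ((-1) ^ r * of_real (c ^ (2 * r))) r"

lemma symbol_mult: "z \<noteq> 0 \<Longrightarrow> (2 - z - 1 / z) * z = - ((1 - z)\<^sup>2)" for z :: complex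
  by (simp add: field_simps power2_eq_square)

lemma four_minus_symbol_mult: "z \<noteq> 0 \<Longrightarrow> (4 - (2 - z - 1 / z)) * z = (1 + z)\<^sup>2" for z :: complex
  by (simp add: field_simps power2_eq_square)

lemma inverse_in_char_roots: "z \<in> char_roots r c \<Longrightarrow> 1 / z \<in> char_roots r c"
  by (simp add: char_roots_def algebra_simps)

lemma norm_symbol:
  assumes "z \<in> char_roots r c" "0 < r" "0 < c"
  shows "norm (2 - z - 1 / z) = c\<^sup>2"
proof -
  have "norm (2 - z - 1 / z) ^ r = (c\<^sup>2) ^ r"
    using assms by (simp add: char_roots_def norm_power[symmetric] power_mult[symmetric] norm_of_real del: of_real_power)
  thus ?thesis using assms by (metis norm_ge_zero power_eq_imp_eq_base zero_le_power2)
qed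

lemma norm_one_minus_root:
  assumes "z \<in> char_roots r c" "0 < r" "0 < c"
  shows "(norm (1 - z))\<^sup>2 = c\<^sup>2 * norm z"
proof -
  have "z \<noteq> 0" using assms by (simp add: char_roots_def)
  hence "norm ((2 - z - 1 / z) * z) = norm (- ((1 - z)\<^sup>2))"
    by (intro arg_cong[of _ _ norm] symbol_mult)
  thus ?thesis using norm_symbol[OF assms] by (simp add: norm_mult norm_power)
qed

lemma norm_root_le:
  assumes "z \<in> char_roots r c" "0 < r" "0 < c" "c < 2"
  shows "norm z \<le> 7"
proof (cases "norm z \<le> 1")
  case False
  have "c\<^sup>2 \<le> 2\<^sup>2" using assms by (intro power_mono) auto
  hence "norm (2 - z - 1 / z) \<le> 4" using norm_symbol[OF assms(1-3)] by simp
  moreover have "norm (1 / z) \<le> 1" using False by (simp add: norm_divide divide_le_eq)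
  moreover have "norm z \<le> 2 + norm (2 - z - 1 / z) + norm (1 / z)"
  proof -
    have "norm (2 - y - w) \<le> 2 + norm y + norm w" for y w :: complex
      using norm_triangle_ineq4[of "2 - y" w] norm_triangle_ineq4[of 2 y] by simp
    from this[of "2 - z - 1 / z" "1 / z"] show ?thesis by simp
  qed
  ultimately show ?thesis by linarith
qed simp

lemma norm_one_minus_root_le:
  assumes "z \<in> char_roots r c" "0 < r" "0 < c" "c < 2"
  shows "norm (1 - z) \<le> 3 * c"
proof -
  have "(norm (1 - z))\<^sup>2 \<le> c\<^sup>2 * 9"
    unfolding norm_one_minus_root[OF assms(1-3)] using norm_root_le[OF assms] by (intro mult_left_mono) auto
  hence "(norm (1 - z))\<^sup>2 \<le> (3 * c)\<^sup>2" by (simp add: power_mult_distrib)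
  from power2_le_imp_le[OF this] show ?thesis using assms(3) by simp
qed

lemma norm_one_minus_root_power:
  assumes "z \<in> char_roots r c" "0 < r" "0 < c" "c < 2"
  shows "norm (1 - z) ^ r \<le> 7 ^ r * c ^ r"
proof -
  have "norm (1 - z) \<le> 7 * c" using norm_one_minus_root_le[OF assms] assms(3) by simp
  hence "norm (1 - z) ^ r \<le> (7 * c) ^ r" by (intro power_mono) auto
  thus ?thesis by (simp add: power_mult_distrib)
qed

lemma poly_char_root_poly:
  assumes "z \<noteq> 0"
  shows "poly (char_root_poly r c) z = (- z) ^ r * ((2 - z - 1 / z) ^ r - of_real (c ^ (2 * r)))"
proof -
  have "(1 - z)\<^sup>2 = (2 - z - 1 / z) * (- z)"
    unfolding mult_minus_right symbol_mult[OF assms] by simp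
  hence "(1 - z) ^ (2 * r) = ((2 - z - 1 / z) * (- z)) ^ r"
    by (simp only: power_mult)
  also have "\<dots> = (- z) ^ r * (2 - z - 1 / z) ^ r"
    by (subst power_mult_distrib) (rule mult.commute)
  finally have *: "(1 - z) ^ (2 * r) = (- z) ^ r * (2 - z - 1 / z) ^ r" .
  have m: "(- z) ^ r = (- 1) ^ r * z ^ r" by (rule power_minus)
  have "poly (char_root_poly r c) z = (1 - z) ^ (2 * r) - (-1) ^ r * of_real (c ^ (2 * r)) * z ^ r"
    by (simp add: char_root_poly_def poly_monom)
  thus ?thesis unfolding * m right_diff_distrib by (simp only: mult.assoc mult.commute mult.left_commute)
qed

lemma char_roots_eq:
  assumes "0 < r"
  shows "char_roots r c = {z. poly (char_root_poly r c) z = 0}"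
proof -
  have "poly (char_root_poly r c) 0 \<noteq> 0" using assms
    by (simp add: char_root_poly_def poly_monom power_0_left)
  show ?thesis
  proof (rule Set.set_eqI)
    fix z
    show "z \<in> char_roots r c \<longleftrightarrow> z \<in> {z. poly (char_root_poly r c) z = 0}"
    proof (cases "z = 0")
      case True
      thus ?thesis using \<open>poly (char_root_poly r c) 0 \<noteq> 0\<close> by (simp add: char_roots_def)
    next
      case False
      hence "(- z) ^ r \<noteq> 0" by simp
      thus ?thesis using False
        by (simp only: char_roots_def mem_Collect_eq poly_char_root_poly[OF False] mult_eq_0_iff) simp
    qed
  qed
qed

lemma degree_char_root_poly:
  assumes "0 < r"
  shows "degree (char_root_poly r c) = 2 * r" "lead_coeff (char_root_poly r c) = 1"
proof -
  have d: "degree ([:1, -1::complex:] ^ (2 * r)) = 2 * r"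
    by (simp add: degree_power_eq)
  have m: "degree (monom ((-1) ^ r * complex_of_real (c ^ (2 * r))) r) < 2 * r"
    using degree_monom_le[of "(-1) ^ r * complex_of_real (c ^ (2 * r))" r] assms by linarith
  show 1: "degree (char_root_poly r c) = 2 * r"
    unfolding char_root_poly_def diff_conv_add_uminus
    using degree_add_eq_left[of "- monom ((-1) ^ r * complex_of_real (c ^ (2 * r))) r" "[:1, -1::complex:] ^ (2 * r)"] d m by simp
  have "lead_coeff ([:1, -1::complex:] ^ (2 * r)) = 1"
    unfolding lead_coeff_power by (simp add: power_mult)
  hence "coeff ([:1, -1::complex:] ^ (2 * r)) (2 * r) = 1" unfolding d .
  thus "lead_coeff (char_root_poly r c) = 1"
    unfolding 1 using assms by (simp add: char_root_poly_def)
qed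

text \<open>At a root the derivative factors as \<open>-r (1 - z)\<^sup>2\<^sup>r\<^sup>-\<^sup>1 (1 + z) / z\<close>. The modulus of \<open>1 - z\<close> is fixed by
those of \<open>z\<close> and \<open>c\<close>. The factor \<open>1 + z\<close>, here in the form \<open>4 - (2 - z - 1/z)\<close>, is not: it is small
when \<open>c\<close> is close to \<open>2\<close> and the two oscillating roots almost collide at \<open>-1\<close>.\<close>

lemma norm_pderiv_char_root_poly:
  assumes z: "z \<in> char_roots r c" and r: "0 < r" and c: "0 < c"
  shows "(norm (poly (pderiv (char_root_poly r c)) z))\<^sup>2
    = (real r)\<^sup>2 * c ^ (2 * (2 * r - 1)) * norm z ^ (2 * (r - 1)) * norm (4 - (2 - z - 1 / z))"
proof -
  have z0: "z \<noteq> 0" using z by (simp add: char_roots_def)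
  let ?k = "(-1) ^ r * complex_of_real (c ^ (2 * r))"
  have root: "(1 - z) ^ (2 * r) = ?k * z ^ r"
    using z r unfolding char_roots_eq[OF r] by (simp add: char_root_poly_def poly_monom)
  have zr: "z * z ^ (r - 1) = z ^ r" using r by (simp add: power_eq_if)
  have "poly (pderiv (char_root_poly r c)) z
      = of_nat (2 * r) * ((1 - z) ^ (2 * r - 1) * (- 1)) - ?k * of_nat r * z ^ (r - 1)"
    using r by (simp add: char_root_poly_def pderiv_diff pderiv_monom poly_monom pderiv_power pderiv_pCons algebra_simps)
  hence "z * poly (pderiv (char_root_poly r c)) z
      = - 2 * of_nat r * z * (1 - z) ^ (2 * r - 1) - of_nat r * (?k * (z * z ^ (r - 1)))"
    by (simp only:) (simp add: algebra_simps)
  also have "?k * (z * z ^ (r - 1)) = (1 - z) * (1 - z) ^ (2 * r - 1)"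
    unfolding zr root[symmetric] using r by (simp add: power_eq_if)
  finally have *: "z * poly (pderiv (char_root_poly r c)) z
      = - 2 * of_nat r * z * (1 - z) ^ (2 * r - 1) - of_nat r * ((1 - z) * (1 - z) ^ (2 * r - 1))" .
  have "- 2 * R * z * P - R * ((1 - z) * P) = - R * P * (1 + z)" for R P
    by (simp add: algebra_simps)
  hence "z * poly (pderiv (char_root_poly r c)) z = - of_nat r * (1 - z) ^ (2 * r - 1) * (1 + z)"
    unfolding * .
  hence "norm z * norm (poly (pderiv (char_root_poly r c)) z) = real r * norm (1 - z) ^ (2 * r - 1) * norm (1 + z)"
    by (drule_tac arg_cong[of _ _ norm]) (simp add: norm_mult norm_power)
  hence "(norm z)\<^sup>2 * (norm (poly (pderiv (char_root_poly r c)) z))\<^sup>2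
     = (real r)\<^sup>2 * ((norm (1 - z))\<^sup>2) ^ (2 * r - 1) * (norm (1 + z))\<^sup>2"
    by (drule_tac arg_cong[of _ _ "\<lambda>x. x\<^sup>2"])
       (simp only: power_mult_distrib power_mult[symmetric] mult.commute[of 2])
  also have "(norm (1 - z))\<^sup>2 = c\<^sup>2 * norm z" by (rule norm_one_minus_root[OF z r c])
  also have "(norm (1 + z))\<^sup>2 = norm (4 - (2 - z - 1 / z)) * norm z"
    unfolding norm_mult[symmetric] four_minus_symbol_mult[OF z0] by (simp add: norm_power)
  also have "(real r)\<^sup>2 * (c\<^sup>2 * norm z) ^ (2 * r - 1) * (norm (4 - (2 - z - 1 / z)) * norm z)
    = (norm z)\<^sup>2 * ((real r)\<^sup>2 * c ^ (2 * (2 * r - 1)) * norm z ^ (2 * (r - 1)) * norm (4 - (2 - z - 1 / z)))"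
  proof -
    have "norm z ^ (2 * r - 1) * norm z = (norm z)\<^sup>2 * norm z ^ (2 * (r - 1))"
    proof -
      have "Suc (2 * r - 1) = 2 + 2 * (r - 1)" using r by simp
      hence "norm z ^ Suc (2 * r - 1) = norm z ^ (2 + 2 * (r - 1))" by simp
      thus ?thesis by (simp only: power_Suc2 power_add)
    qed
    note e = this
    have A: "X * (C * p) * (Y * q) = X * C * Y * (p * q)" for X Y C p q :: real
      by (simp add: algebra_simps)
    have B: "X * C * Y * (p * q) = p * (X * C * q * Y)" for X Y C p q :: real
      by (simp add: algebra_simps)
    have "X * (c ^ (2 * (2 * r - 1)) * norm z ^ (2 * r - 1)) * (Y * norm z)
      = (norm z)\<^sup>2 * (X * c ^ (2 * (2 * r - 1)) * norm z ^ (2 * (r - 1)) * Y)" for X Y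
      unfolding A e by (rule B)
    thus ?thesis by (simp only: power_mult_distrib power_mult[symmetric])
  qed
  finally show ?thesis using z0 by simp
qed

lemma symbol_neq_four:
  assumes "z \<in> char_roots r c" "0 < r" "0 < c" "c < 2"
  shows "2 - z - 1 / z \<noteq> 4"
proof
  assume "2 - z - 1 / z = 4"
  hence "c\<^sup>2 = 4" using norm_symbol[OF assms(1-3)] by (simp only: norm_numeral)
  moreover have "c\<^sup>2 < 2\<^sup>2" using assms by (intro power_strict_mono) auto
  ultimately show False by simp
qed

text \<open>Since \<open>c < 2\<close>, no root has \<open>2 - z - 1/z = 4\<close>; so the derivative vanishes at none of them.\<close>

lemma char_roots_simple:
  assumes "0 < r" "0 < c" "c < 2"
  shows "finite (char_roots r c)" "card (char_roots r c) = 2 * r"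
    "z \<in> char_roots r c \<Longrightarrow> (\<Prod>w\<in>char_roots r c - {z}. z - w) = poly (pderiv (char_root_poly r c)) z"
proof -
  let ?R = "char_root_poly r c"
  have R0: "?R \<noteq> 0" using degree_char_root_poly(2)[OF assms(1), of c] by auto
  show fin: "finite (char_roots r c)"
    unfolding char_roots_eq[OF assms(1)] by (rule poly_roots_finite[OF R0])
  have "rsquarefree ?R" unfolding rsquarefree_roots
  proof safe
    fix a assume a: "poly ?R a = 0" "poly (pderiv ?R) a = 0"
    hence ar: "a \<in> char_roots r c" unfolding char_roots_eq[OF assms(1)] by simp
    have "a \<noteq> 0" using ar by (simp add: char_roots_def)
    have "4 - (2 - a - 1 / a) \<noteq> 0" using symbol_neq_four[OF ar assms] by (metis right_minus_eq)
    hence "0 < norm (4 - (2 - a - 1 / a))" by (simp only: zero_less_norm_iff) simp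
    hence "0 < (real r)\<^sup>2 * c ^ (2 * (2 * r - 1)) * norm a ^ (2 * (r - 1)) * norm (4 - (2 - a - 1 / a))"
      using assms \<open>a \<noteq> 0\<close> by (intro mult_pos_pos zero_less_power) auto
    thus False unfolding norm_pderiv_char_root_poly[OF ar assms(1,2), symmetric] a(2) by simp
  qed
  from complex_poly_decompose_rsquarefree[OF this]
  have dec: "(\<Prod>z\<in>char_roots r c. [:-z, 1:]) = ?R"
    unfolding char_roots_eq[OF assms(1)] degree_char_root_poly(2)[OF assms(1)] by simp
  have "degree (\<Prod>z\<in>char_roots r c. [:-z, 1::complex:]) = card (char_roots r c)"
    by (subst degree_prod_eq_sum_degree) auto
  thus "card (char_roots r c) = 2 * r" unfolding dec degree_char_root_poly(1)[OF assms(1)] by simp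
  assume z: "z \<in> char_roots r c"
  have "?R = [:-z, 1:] * (\<Prod>w\<in>char_roots r c - {z}. [:-w, 1:])"
    unfolding dec[symmetric] using fin z by (subst prod.remove[of _ z]) auto
  hence "pderiv ?R = pderiv ([:-z, 1:] * (\<Prod>w\<in>char_roots r c - {z}. [:-w, 1:]))" by simp
  thus "(\<Prod>w\<in>char_roots r c - {z}. z - w) = poly (pderiv ?R) z"
    by (simp only: pderiv_mult poly_add poly_mult) (simp add: pderiv_pCons poly_prod)
qed

text \<open>With \<open>w = y/x\<close> an \<open>r\<close>-th root of unity other than \<open>1\<close>, the sum \<open>\<Sum>k<r. 1 - w\<^sup>k\<close> equals \<open>r\<close>, while
each term is at most \<open>r \<bar>1 - w\<bar>\<close>.\<close>

lemma equal_powers_separated: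
  fixes x y :: complex
  assumes "0 < r" "x ^ r = y ^ r" "x \<noteq> y"
  shows "norm x \<le> real r * norm (x - y)"
proof (cases "x = 0")
  case False
  define w where "w = y / x"
  have "w ^ r = x ^ r / x ^ r" by (simp only: w_def power_divide assms(2))
  hence w: "w ^ r = 1" "w \<noteq> 1" using assms(3) False by (auto simp: w_def)
  have nw: "norm w = 1" 
  proof -
    have "norm w ^ r = 1 ^ r" using w(1) by (simp add: norm_power[symmetric])
    thus ?thesis using assms(1) by (intro power_eq_imp_eq_base[of "norm w" r 1]) auto
  qed
  have "(\<Sum>k<r. w ^ k) = 0" using w by (simp add: geometric_sum)
  hence "real r = norm (\<Sum>k<r. 1 - w ^ k)" by (simp add: sum_subtractf)
  also have "\<dots> \<le> (\<Sum>k<r. norm (1 ^ k - w ^ k))"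
    by (simp add: norm_sum)
  also have "\<dots> \<le> (\<Sum>k<r. real r * norm (1 - w))"
  proof (rule sum_mono)
    fix k assume "k \<in> {..<r}"
    have "norm (1 ^ k - w ^ k) \<le> real k * norm (1 - w)"
      using nw by (intro norm_power_diff) auto
    also have "\<dots> \<le> real r * norm (1 - w)" using \<open>k \<in> {..<r}\<close> by (intro mult_right_mono) auto
    finally show "norm (1 ^ k - w ^ k) \<le> real r * norm (1 - w)" .
  qed
  finally have "1 \<le> real r * norm (1 - w)" using assms(1) by (simp add: field_simps)
  hence "norm x * 1 \<le> norm x * (real r * norm (1 - w))" by (intro mult_left_mono) auto
  also have "\<dots> = real r * norm (x * (1 - w))" by (simp add: norm_mult)
  also have "x * (1 - w) = x - y" using False by (simp add: w_def algebra_simps)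
  finally show ?thesis by simp
qed simp

text \<open>Outside the oscillating pair the number \<open>y = 2 - z - 1/z\<close> stays away from \<open>4\<close>: either \<open>\<bar>y\<bar> = c\<^sup>2\<close> is
at most \<open>1\<close>, or \<open>y\<close> has distance at least \<open>c\<^sup>2/r\<close> from \<open>c\<^sup>2\<close>, which is the point of the circle
\<open>\<bar>y\<bar> = c\<^sup>2\<close> nearest to \<open>4\<close>.\<close>

lemma norm_pderiv_char_root_poly_ge:
  assumes z: "z \<in> char_roots r c" and r: "2 \<le> r" and c: "0 < c" "c < 2"
    and ne: "2 - z - 1 / z \<noteq> of_real (c\<^sup>2)"
  shows "norm (poly (pderiv (char_root_poly r c)) z) \<ge> c ^ (2 * r - 1) * norm z ^ (r - 1)"
proof -
  define y where "y = 2 - z - 1 / z"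
  have yr: "y ^ r = of_real (c\<^sup>2) ^ r" using z by (simp add: char_roots_def y_def power_mult)
  have ny: "norm y = c\<^sup>2" unfolding y_def by (rule norm_symbol[OF z]) (use r c in auto)
  have "1 \<le> real r * (2 * norm (4 - y))"
  proof (cases "c\<^sup>2 \<le> 1")
    case True
    have "norm (4 - y) \<ge> 3" using norm_triangle_ineq2[of 4 y] ny True by simp
    moreover have "real r * (2 * norm (4 - y)) \<ge> 1 * (2 * norm (4 - y))" using r by (intro mult_right_mono) auto
    ultimately show ?thesis by linarith
  next
    case False
    have c2: "c\<^sup>2 \<le> 2\<^sup>2" using c by (intro power_mono) auto
    have "norm y \<le> real r * norm (y - of_real (c\<^sup>2))"
      using r yr ne by (intro equal_powers_separated) (auto simp: y_def)
    moreover have "norm (y - of_real (c\<^sup>2)) \<le> norm (4 - y) + norm (of_real (4 - c\<^sup>2) :: complex)"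
      using norm_triangle_ineq4[of "of_real (4 - c\<^sup>2)" "4 - y"] by simp
    moreover have "norm (of_real (4 - c\<^sup>2) :: complex) = 4 - c\<^sup>2"
      using c2 by (simp only: norm_of_real) simp
    moreover have "4 - c\<^sup>2 \<le> norm (4 - y)" using norm_triangle_ineq2[of 4 y] ny by simp
    ultimately have "norm (y - of_real (c\<^sup>2)) \<le> 2 * norm (4 - y)" "1 \<le> real r * norm (y - of_real (c\<^sup>2))"
      using False ny by auto
    thus ?thesis using mult_left_mono[of "norm (y - of_real (c\<^sup>2))" "2 * norm (4 - y)" "real r"] by linarith
  qed
  also have "real r * (2 * norm (4 - y)) \<le> real r * (real r * norm (4 - y))"
    using r by (intro mult_left_mono mult_right_mono) auto
  finally have one: "1 \<le> (real r)\<^sup>2 * norm (4 - y)" by (simp add: power2_eq_square mult.assoc)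
  have "(c ^ (2 * r - 1) * norm z ^ (r - 1))\<^sup>2 = 1 * (c ^ (2 * (2 * r - 1)) * norm z ^ (2 * (r - 1)))"
    by (simp add: power_mult_distrib power_mult[symmetric] mult.commute)
  also have "\<dots> \<le> ((real r)\<^sup>2 * norm (4 - y)) * (c ^ (2 * (2 * r - 1)) * norm z ^ (2 * (r - 1)))"
    using one c by (intro mult_right_mono) auto
  also have "\<dots> = (norm (poly (pderiv (char_root_poly r c)) z))\<^sup>2"
    unfolding y_def by (subst norm_pderiv_char_root_poly[OF z]) (use r c in auto)
  finally show ?thesis by (rule power2_le_imp_le) simp
qed

lemma exists_char_root:
  assumes "y ^ r = of_real (c ^ (2 * r))"
  obtains z where "z \<in> char_roots r c" "2 - z - 1 / z = y"
proof -
  \<comment> \<open>a root of \<open>z\<^sup>2 - (2 - y) z + 1\<close>\<close>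
  define z where "z = (2 - y + csqrt ((2 - y)\<^sup>2 - 4)) / 2"
  have "2 * z - (2 - y) = csqrt ((2 - y)\<^sup>2 - 4)" by (simp add: z_def field_simps)
  hence "(2 * z - (2 - y))\<^sup>2 = (2 - y)\<^sup>2 - 4" by (simp only: power2_csqrt)
  moreover have "(2 * z - (2 - y))\<^sup>2 - ((2 - y)\<^sup>2 - 4) = 4 * (z * z - (2 - y) * z + 1)"
    by (simp add: power2_eq_square algebra_simps)
  ultimately have "4 * (z * z - (2 - y) * z + 1) = 0" by (simp only: diff_self)
  hence *: "z * z - (2 - y) * z + 1 = 0" by (simp only: mult_eq_0_iff) simp
  hence "z \<noteq> 0" by auto
  moreover from this * have "2 - z - 1 / z = y" by (simp add: field_simps)
  ultimately show ?thesis using that[of z] assms by (simp add: char_roots_def)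
qed

text \<open>The quadratic equation for \<open>z\<close> has real coefficients, root product \<open>1\<close> and, as
\<open>\<bar>2 - c\<^sup>2\<bar> < 2\<close>, no real root. So the second root is both \<open>cnj z\<close> and \<open>1/z\<close>.\<close>

lemma oscillating_root_unit:
  fixes z :: complex
  assumes "z \<noteq> 0" "2 - z - 1 / z = of_real (c\<^sup>2)" "0 < c" "c < 2"
  shows "norm z = 1"
proof -
  have c2: "0 < c\<^sup>2" "c\<^sup>2 < 4" using assms power_strict_mono[of c 2 2] by auto
  have sum: "z + 1 / z = of_real (2 - c\<^sup>2)"
    using assms(2) by (simp add: algebra_simps)
  hence q: "z * z + 1 = of_real (2 - c\<^sup>2) * z"
    using assms(1) by (simp add: field_simps)
  have "cnj z * cnj z + 1 = of_real (2 - c\<^sup>2) * cnj z"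
    using arg_cong[OF q, of cnj] by simp
  hence "(cnj z - z) * (cnj z + z - of_real (2 - c\<^sup>2)) = 0"
  proof -
    have "(w - z) * (w + z - k) = (w * w + 1 - k * w) - (z * z + 1 - k * z)" for w k
      by (simp add: algebra_simps)
    thus ?thesis using q \<open>cnj z * cnj z + 1 = of_real (2 - c\<^sup>2) * cnj z\<close> by (simp only:) simp
  qed
  moreover have "cnj z \<noteq> z"
  proof
    assume "cnj z = z"
    then obtain x where x: "z = of_real x" by (metis Reals_cases Reals_cnj_iff)
    have "x * x + 1 = (2 - c\<^sup>2) * x"
      using q unfolding x by (metis of_real_1 of_real_add of_real_eq_iff of_real_mult)
    hence "(2 * x - (2 - c\<^sup>2))\<^sup>2 = (2 - c\<^sup>2)\<^sup>2 - 4" by (simp add: power2_eq_square algebra_simps)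
    hence "(2 - c\<^sup>2)\<^sup>2 \<ge> 4" by (metis diff_ge_0_iff_ge zero_le_power2)
    hence "(2 - c\<^sup>2)\<^sup>2 \<ge> 2\<^sup>2" by simp
    hence "\<bar>2\<bar> \<le> \<bar>2 - c\<^sup>2\<bar>" by (simp only: abs_le_square_iff)
    thus False using c2 by linarith
  qed
  ultimately have "cnj z + z - of_real (2 - c\<^sup>2) = 0" by (simp only: mult_eq_0_iff right_minus_eq) blast
  hence "cnj z = of_real (2 - c\<^sup>2) - z" by (metis add_diff_cancel_right' eq_iff_diff_eq_0)
  hence "cnj z = (z + 1 / z) - z" unfolding sum .
  hence "cnj z = 1 / z" by simp
  hence "z * cnj z = 1" using assms(1) by simp
  hence "of_real ((norm z)\<^sup>2) = (1::complex)" by (simp only: complex_norm_square)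
  hence "(norm z)\<^sup>2 = 1" by (metis of_real_1 of_real_eq_iff)
  thus ?thesis using norm_ge_zero[of z] by (simp only: power2_eq_1_iff) linarith
qed

section \<open>Overflow polynomials and the conserved state\<close>

definition gen_poly :: "(nat \<Rightarrow> real) \<Rightarrow> nat \<Rightarrow> complex poly" where
  "gen_poly a n = (\<Sum>i<n. monom (of_real (a i)) i)"

lemma coeff_gen_poly: "coeff (gen_poly a n) i = (if i < n then of_real (a i) else 0)"
  by (simp add: gen_poly_def coeff_sum)

lemma poly_gen_poly: "poly (gen_poly a n) z = (\<Sum>i<n. of_real (a i) * z ^ i)"
  by (simp add: gen_poly_def poly_sum poly_monom)

lemma gen_poly_0 [simp]: "gen_poly a 0 = 0"
  by (simp add: gen_poly_def)

lemma gen_poly_Suc: "gen_poly a (Suc n) = gen_poly a n + monom (of_real (a n)) n"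
  by (simp add: gen_poly_def)

lemma degree_gen_poly: "degree (gen_poly a n) \<le> n - 1"
  by (rule degree_le) (auto simp: coeff_gen_poly)

definition reversed :: "nat \<Rightarrow> (nat \<Rightarrow> real) \<Rightarrow> nat \<Rightarrow> real" where
  "reversed N a j = a (N - Suc j)"

lemma sum_reversed: "(\<Sum>i<N. f (reversed N a i)) = (\<Sum>i<N. f (a i))"
  unfolding reversed_def by (rule sum.nat_diff_reindex)

lemma gen_poly_reversed_reversed: "gen_poly (reversed N (reversed N a)) N = gen_poly a N"
  unfolding gen_poly_def reversed_def by (rule sum.cong) auto

lemma reversed_tail:
  assumes "z \<noteq> 0" "n \<le> N" "0 < N"
  shows "z ^ N * poly (gen_poly (reversed N a) (N - n)) (1 / z) = z * (poly (gen_poly a N) z - poly (gen_poly a n) z)"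
proof -
  have "poly (gen_poly a N) z - poly (gen_poly a n) z = (\<Sum>i\<in>{n..<N}. of_real (a i) * z ^ i)"
  proof -
    have "{..<N} = {..<n} \<union> {n..<N}" using assms by auto
    hence "poly (gen_poly a N) z = (\<Sum>i\<in>{..<n} \<union> {n..<N}. of_real (a i) * z ^ i)" by (simp add: poly_gen_poly)
    also have "\<dots> = (\<Sum>i<n. of_real (a i) * z ^ i) + (\<Sum>i\<in>{n..<N}. of_real (a i) * z ^ i)"
      by (rule sum.union_disjoint) auto
    finally show ?thesis by (simp add: poly_gen_poly)
  qed
  also have "z * \<dots> = (\<Sum>i\<in>{n..<N}. of_real (a i) * z ^ Suc i)"
    by (simp add: sum_distrib_left mult.left_commute)
  also have "\<dots> = (\<Sum>i<N-n. of_real (reversed N a i) * z ^ (N - i))"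
    by (rule sum.reindex_bij_witness[of _ "\<lambda>i. N - Suc i" "\<lambda>i. N - Suc i"])
       (auto simp: reversed_def Suc_diff_Suc)
  also have "\<dots> = (\<Sum>i<N-n. z ^ N * (of_real (reversed N a i) * (1 / z) ^ i))"
  proof (rule sum.cong)
    fix i assume "i \<in> {..<N - n}"
    hence "z ^ N = z ^ (N - i) * z ^ i" by (simp flip: power_add)
    thus "of_real (reversed N a i) * z ^ (N - i) = z ^ N * (of_real (reversed N a i) * (1 / z) ^ i)"
      using assms(1) by (simp add: power_one_over)
  qed simp
  finally show ?thesis by (simp add: poly_gen_poly sum_distrib_left)
qed

text \<open>If \<open>(1 - z)\<^sup>r\<close> maps the full sequence \<open>a\<close> to \<open>c\<^sup>r b\<close>, the difference inside \<open>poly_shift\<close> has no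
coefficients below \<open>n\<close>: what remains is the part of \<open>(1 - z)\<^sup>r\<close> applied to the first \<open>n\<close> entries
that spills over the cut.\<close>

definition overflow :: "nat \<Rightarrow> real \<Rightarrow> (nat \<Rightarrow> real) \<Rightarrow> (nat \<Rightarrow> real) \<Rightarrow> nat \<Rightarrow> complex poly" where
  "overflow r c a b n = poly_shift n ([:1, -1:] ^ r * gen_poly a n - smult (of_real (c ^ r)) (gen_poly b n))"

lemma overflow_0 [simp]: "overflow r c a b 0 = 0"
  by (rule poly_eqI) (simp add: overflow_def gen_poly_def coeff_poly_shift)

lemma degree_overflow:
  assumes "0 < r"
  shows "degree (overflow r c a b n) < r"
proof (cases "n = 0")
  case False
  let ?f = "[:1, -1:] ^ r * gen_poly a n - smult (of_real (c ^ r)) (gen_poly b n)"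
  have 1: "degree ([:1, -1:] ^ r * gen_poly a n) \<le> r + (n - 1)"
    using degree_mult_le[of "[:1, -1:] ^ r" "gen_poly a n"] degree_gen_poly[of a n] by (simp add: degree_power_eq)
  have 2: "degree (smult (of_real (c ^ r)) (gen_poly b n)) \<le> r + (n - 1)"
    using degree_gen_poly[of b n] degree_smult_le[of "of_real (c ^ r)" "gen_poly b n"] by linarith
  have "degree ?f \<le> r + (n - 1)" using 1 2 by (rule degree_diff_le)
  hence "coeff ?f (k + n) = 0" if "r - 1 < k" for k
    using that False by (intro coeff_eq_0) auto
  hence "degree (overflow r c a b n) \<le> r - 1"
    by (intro degree_le) (auto simp: overflow_def coeff_poly_shift)
  thus ?thesis using assms by linarith
qed (use assms in simp)

text \<open>Coefficients of \<open>(1 - z)\<^sup>r\<close> times a generating polynomial are backward differences of order \<open>r\<close> with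
zero continuation to the left, which is the action of \<open>D\<^sup>r\<close>. The transpose is the same operation read
from right to left. In this form the two equations are exchanged by reversal of the indices, so that
every statement about the right end of the sequences gives one about the left end.\<close>

locale singular_pair =
  fixes N r :: nat and c :: real and v u :: "nat \<Rightarrow> real"
  assumes N_pos: "0 < N" and r_ge: "2 \<le> r" and c_pos: "0 < c" and c_less: "c < 2"
    and forward: "\<And>i. i < N \<Longrightarrow> coeff ([:1, -1:] ^ r * gen_poly v N) i = of_real (c ^ r * u i)"
    and backward: "\<And>i. i < N \<Longrightarrow>
      coeff ([:1, -1:] ^ r * gen_poly (reversed N u) N) i = of_real (c ^ r * reversed N v i)"
    and norm_v: "(\<Sum>i<N. (v i)\<^sup>2) = 1" and norm_u: "(\<Sum>i<N. (u i)\<^sup>2) = 1"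

lemma singular_pair_reversed:
  assumes "singular_pair N r c v u"
  shows "singular_pair N r c (reversed N u) (reversed N v)"
proof -
  interpret singular_pair N r c v u by fact
  show ?thesis
  proof
    show "coeff ([:1, -1:] ^ r * gen_poly (reversed N (reversed N v)) N) i
        = of_real (c ^ r * reversed N (reversed N u) i)" if "i < N" for i
    proof -
      have "reversed N (reversed N u) i = u i" using that by (simp add: reversed_def)
      thus ?thesis unfolding gen_poly_reversed_reversed using forward[OF that] by simp
    qed
  qed (use N_pos r_ge c_pos c_less backward norm_u norm_v in
      \<open>simp_all add: sum_reversed[of "\<lambda>x. x\<^sup>2"]\<close>)
qed

context singular_pair
begin

lemma r_pos: "0 < r" using r_ge by simp

lemma forward_truncated:
  assumes "n \<le> N" "i < n"
  shows "coeff ([:1, -1:] ^ r * gen_poly v n) i = of_real (c ^ r * u i)"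
proof -
  have "coeff ([:1, -1:] ^ r * gen_poly v n) i = coeff ([:1, -1:] ^ r * gen_poly v N) i"
    unfolding coeff_mult by (rule sum.cong) (use assms in \<open>auto simp: coeff_gen_poly\<close>)
  thus ?thesis using forward[of i] assms by simp
qed

lemma overflow_poly:
  assumes "n \<le> N"
  shows "[:1, -1:] ^ r * gen_poly v n - smult (of_real (c ^ r)) (gen_poly u n) = monom 1 n * overflow r c v u n"
proof (rule poly_eqI)
  fix i
  show "coeff ([:1, -1:] ^ r * gen_poly v n - smult (of_real (c ^ r)) (gen_poly u n)) i
      = coeff (monom 1 n * overflow r c v u n) i"
  proof (cases "i < n")
    case True
    thus ?thesis using forward_truncated[OF assms True] by (simp add: coeff_monom_mult coeff_gen_poly)
  next
    case False
    thus ?thesis by (simp add: coeff_monom_mult overflow_def coeff_poly_shift)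
  qed
qed

lemma overflow_eval:
  assumes "n \<le> N"
  shows "z ^ n * poly (overflow r c v u n) z
    = (1 - z) ^ r * poly (gen_poly v n) z - of_real (c ^ r) * poly (gen_poly u n) z"
  using arg_cong[OF overflow_poly[OF assms], of "\<lambda>p. poly p z"]
  by (simp add: poly_monom poly_power)

text \<open>The overflow to the left of the entries from \<open>n\<close> on: the overflow of the reversed pair, cut after its
first \<open>N - n\<close> entries.\<close>

definition tail_overflow :: "nat \<Rightarrow> complex poly" where
  "tail_overflow n = overflow r c (reversed N u) (reversed N v) (N - n)"

lemma tail_overflow_N [simp]: "tail_overflow N = 0"
  by (simp add: tail_overflow_def)

lemma tail_overflow_eval:
  assumes "n \<le> N" "z \<noteq> 0"
  shows "z ^ n * poly (tail_overflow n) (1 / z)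
    = z * ((1 - 1 / z) ^ r * (poly (gen_poly u N) z - poly (gen_poly u n) z)
           - of_real (c ^ r) * (poly (gen_poly v N) z - poly (gen_poly v n) z))"
proof -
  interpret rev: singular_pair N r c "reversed N u" "reversed N v"
    by (rule singular_pair_reversed) (rule singular_pair_axioms)
  have "z ^ N * (1 / z) ^ (N - n) = z ^ n"
  proof -
    have "z ^ N = z ^ n * z ^ (N - n)" using assms(1) by (simp flip: power_add)
    thus ?thesis using assms(2) by (simp add: power_one_over)
  qed
  hence "z ^ n * poly (tail_overflow n) (1 / z)
      = z ^ N * ((1 / z) ^ (N - n) * poly (overflow r c (reversed N u) (reversed N v) (N - n)) (1 / z))"
    by (simp only: tail_overflow_def mult.assoc[symmetric])
  also have "(1 / z) ^ (N - n) * poly (overflow r c (reversed N u) (reversed N v) (N - n)) (1 / z)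
    = (1 - 1 / z) ^ r * poly (gen_poly (reversed N u) (N - n)) (1 / z)
      - of_real (c ^ r) * poly (gen_poly (reversed N v) (N - n)) (1 / z)"
    by (rule rev.overflow_eval) simp
  also have "z ^ N * \<dots> = (1 - 1 / z) ^ r * (z ^ N * poly (gen_poly (reversed N u) (N - n)) (1 / z))
      - of_real (c ^ r) * (z ^ N * poly (gen_poly (reversed N v) (N - n)) (1 / z))"
    by (simp only: right_diff_distrib mult.left_commute)
  finally show ?thesis
    unfolding reversed_tail[OF assms(2,1) N_pos]
    by (simp only: right_diff_distrib mult.left_commute)
qed

text \<open>As a function of \<open>z\<close> this depends only on the last \<open>r\<close> entries of \<open>v\<close> before the cut and the first \<open>r\<close>
entries of \<open>u\<close> after it. At a root \<open>z\<close> of the recurrence it is, up to a constant, the amplitude of the mode \<open>z\<close>.\<close>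

definition state :: "nat \<Rightarrow> complex \<Rightarrow> complex" where
  "state n z = (1 - z) ^ r * poly (tail_overflow n) (1 / z) - of_real (c ^ r) * z * poly (overflow r c v u n) z"

text \<open>The two cut equations read \<open>(1 - z)\<^sup>r V\<^sub>n - c\<^sup>r U\<^sub>n = z\<^sup>n p\<^sub>n\<close> and
\<open>z ((1 - 1/z)\<^sup>r U\<^sub>n - c\<^sup>r V\<^sub>n) = t\<^sub>0 - z\<^sup>n t\<^sub>n\<close>, with \<open>p\<^sub>n\<close> and \<open>t\<^sub>n\<close> the two overflows. At a root
their coefficient matrix in \<open>U\<^sub>n\<close>, \<open>V\<^sub>n\<close> is singular, as \<open>(1 - z)\<^sup>r (1 - 1/z)\<^sup>r = c\<^sup>2\<^sup>r\<close>. The linear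
combination that removes \<open>U\<^sub>n\<close> and \<open>V\<^sub>n\<close> relates the overflows at \<open>n\<close> to \<open>t\<^sub>0\<close>.\<close>

lemma state_conserved:
  assumes "z \<in> char_roots r c" "n \<le> N"
  shows "(1 - z) ^ r * poly (tail_overflow 0) (1 / z) = z ^ n * state n z"
proof -
  have z: "z \<noteq> 0" using assms(1) by (simp add: char_roots_def)
  let ?s = "complex_of_real (c ^ r)" and ?U = "poly (gen_poly u n) z" and ?V = "poly (gen_poly v n) z"
  have "(1 - z) * (1 - 1 / z) = 2 - z - 1 / z" using z by (simp add: field_simps)
  hence "(1 - z) ^ r * (1 - 1 / z) ^ r = (2 - z - 1 / z) ^ r" by (simp only: power_mult_distrib[symmetric])
  also have "\<dots> = of_real (c ^ (2 * r))" using assms(1) by (simp add: char_roots_def)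
  also have "\<dots> = ?s * ?s" by (simp add: mult_2 power_add)
  finally have root: "(1 - z) ^ r * (1 - 1 / z) ^ r = ?s * ?s" .
  have "poly (tail_overflow 0) (1 / z) - z ^ n * poly (tail_overflow n) (1 / z)
      = z * ((1 - 1 / z) ^ r * ?U - ?s * ?V)"
  proof -
    have "poly (tail_overflow 0) (1 / z) = z * ((1 - 1 / z) ^ r * poly (gen_poly u N) z - ?s * poly (gen_poly v N) z)"
      using tail_overflow_eval[OF _ z, of 0] by simp
    thus ?thesis unfolding tail_overflow_eval[OF assms(2) z] by (simp add: algebra_simps)
  qed
  hence "(1 - z) ^ r * (poly (tail_overflow 0) (1 / z) - z ^ n * poly (tail_overflow n) (1 / z))
      = z * ((1 - z) ^ r * (1 - 1 / z) ^ r * ?U - ?s * ((1 - z) ^ r * ?V))"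
    by (simp only:) (simp only: right_diff_distrib mult.assoc mult.left_commute)
  also have "\<dots> = - ?s * z * ((1 - z) ^ r * ?V - ?s * ?U)"
    unfolding root by (simp add: algebra_simps)
  also have "\<dots> = - ?s * z * (z ^ n * poly (overflow r c v u n) z)"
    unfolding overflow_eval[OF assms(2)] ..
  finally show ?thesis unfolding state_def by (simp add: algebra_simps)
qed

lemma state_0: "state 0 z = (1 - z) ^ r * poly (tail_overflow 0) (1 / z)"
  by (simp add: state_def)

lemma state_N: "state N z = - of_real (c ^ r) * z * poly (overflow r c v u N) z"
  by (simp add: state_def)

text \<open>The factors \<open>z\<^sup>n\<close> and \<open>z\<^sup>-\<^sup>n\<close> of the states at \<open>z\<close> and \<open>1/z\<close> cancel, so the product is a conserved
quantity that depends on local data only. At \<open>n = N\<close> nothing lies to the right of the cut.\<close>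

lemma state_product:
  assumes "z \<in> char_roots r c" "n \<le> N"
  shows "of_real (c ^ (2 * r)) * (poly (overflow r c v u N) z * poly (overflow r c v u N) (1 / z))
    = state n z * state n (1 / z)"
proof -
  have z: "z \<noteq> 0" using assms(1) by (simp add: char_roots_def)
  have eq: "z ^ k * state k z * ((1 / z) ^ k * state k (1 / z)) = state k z * state k (1 / z)" for k
  proof -
    have "z ^ k * (1 / z) ^ k = 1" using z by (simp add: power_one_over)
    moreover have "a * s * (b * t) = (a * b) * (s * t)" for a b s t :: complex by (simp add: algebra_simps)
    ultimately show ?thesis by simp
  qed
  have "state n z * state n (1 / z) = z ^ n * state n z * ((1 / z) ^ n * state n (1 / z))" by (simp only: eq)
  also have "\<dots> = z ^ N * state N z * ((1 / z) ^ N * state N (1 / z))"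
    unfolding state_conserved[OF assms, symmetric]
      state_conserved[OF inverse_in_char_roots[OF assms(1)] assms(2), symmetric]
      state_conserved[OF assms(1) order.refl, symmetric]
      state_conserved[OF inverse_in_char_roots[OF assms(1)] order.refl, symmetric] ..
  also have "\<dots> = state N z * state N (1 / z)" by (rule eq)
  also have "\<dots> = of_real (c ^ (2 * r)) * (poly (overflow r c v u N) z * poly (overflow r c v u N) (1 / z))"
    unfolding state_N using z by (simp add: mult_2 power_add)
  finally show ?thesis by simp
qed

lemma overflow_cnj:
  "norm z = 1 \<Longrightarrow> poly (overflow r c v u N) (1 / z) = cnj (poly (overflow r c v u N) z)"
proof -
  assume nz: "norm z = 1"
  hence z: "z \<noteq> 0" by auto
  have w: "1 / z = cnj z"
    using nz z by (simp add: field_simps complex_norm_square[symmetric])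
  have g: "poly (gen_poly a n) (cnj z) = cnj (poly (gen_poly a n) z)" for a n
    by (simp add: poly_gen_poly)
  have "(cnj z) ^ N * poly (overflow r c v u N) (cnj z) = cnj (z ^ N * poly (overflow r c v u N) z)"
    unfolding overflow_eval[OF order.refl] by (simp add: g)
  hence "(cnj z) ^ N * poly (overflow r c v u N) (cnj z) = (cnj z) ^ N * cnj (poly (overflow r c v u N) z)"
    by simp
  moreover have "(cnj z) ^ N \<noteq> 0" using z by simp
  ultimately show ?thesis unfolding w by (simp only: mult_cancel_left) blast
qed

end

section \<open>Bounds for the overflow and the state at the roots\<close>

lemma L2_set_sum_le:
  assumes "finite A"
  shows "L2_set (\<lambda>n. \<Sum>a\<in>A. f a n) S \<le> (\<Sum>a\<in>A. L2_set (f a) S)"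
  using assms
proof (induction A rule: finite_induct)
  case empty
  show ?case by (simp add: L2_set_def)
next
  case (insert a A)
  have "L2_set (\<lambda>n. f a n + (\<Sum>a\<in>A. f a n)) S \<le> L2_set (f a) S + L2_set (\<lambda>n. \<Sum>a\<in>A. f a n) S"
    by (rule L2_set_triangle_ineq)
  thus ?case using insert by simp
qed

text \<open>The discounted sums satisfy \<open>x F\<^sub>n\<^sub>+\<^sub>1 = F\<^sub>n + a\<^sub>n\<close>, so their norm \<open>A\<close> satisfies \<open>x A \<le> A + 1\<close>.\<close>

lemma discounted_sum_L2:
  fixes x :: real
  assumes "1 < x" and a: "(\<Sum>i<N. (a i)\<^sup>2) = 1"
  shows "L2_set (\<lambda>n. norm (poly (gen_poly a n) (of_real x)) / x ^ n) {..N} \<le> 1 / (x - 1)"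
proof -
  define F where "F n = (\<Sum>i<n. a i * x ^ i) / x ^ n" for n
  have F0: "F 0 = 0" by (simp add: F_def)
  have FS: "F (Suc n) = 1 / x * (F n + a n)" for n
    using assms(1) by (simp add: F_def field_simps)
  have "norm (poly (gen_poly a n) (of_real x)) / x ^ n = \<bar>F n\<bar>" for n
  proof -
    have "poly (gen_poly a n) (of_real x) = of_real (\<Sum>i<n. a i * x ^ i)" by (simp add: poly_gen_poly)
    hence "norm (poly (gen_poly a n) (of_real x)) = \<bar>\<Sum>i<n. a i * x ^ i\<bar>" by (simp only: norm_of_real)
    thus ?thesis using assms(1) by (simp add: F_def)
  qed
  hence "L2_set (\<lambda>n. norm (poly (gen_poly a n) (of_real x)) / x ^ n) {..N} = L2_set F {..N}"
    by (simp add: L2_set_def)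
  moreover have "L2_set F {..N} \<le> 1 / (x - 1)"
  proof -
    have "(\<Sum>n\<le>N. (F n)\<^sup>2) = (\<Sum>n<N. (F (Suc n))\<^sup>2)"
      by (simp add: sum.atMost_shift F0)
    hence "L2_set F {..N} = L2_set (\<lambda>n. 1 / x * (F n + a n)) {..<N}"
      by (simp add: L2_set_def FS)
    also have "\<dots> = 1 / x * L2_set (\<lambda>n. F n + a n) {..<N}"
      using assms(1) by (intro L2_set_right_distrib[symmetric]) simp
    also have "\<dots> \<le> 1 / x * (L2_set F {..<N} + L2_set a {..<N})"
      using assms(1) by (intro mult_left_mono L2_set_triangle_ineq) simp
    also have "L2_set a {..<N} = 1" by (simp add: L2_set_def a)
    finally have "x * L2_set F {..N} \<le> L2_set F {..<N} + 1"
      using assms(1) by (simp add: field_simps)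
    moreover have "L2_set F {..<N} \<le> L2_set F {..N}"
      unfolding L2_set_def by (intro real_sqrt_le_mono sum_mono2) auto
    ultimately have "(x - 1) * L2_set F {..N} \<le> 1" by (simp add: left_diff_distrib)
    thus ?thesis using assms(1) by (simp add: pos_le_divide_eq mult.commute)
  qed
  ultimately show ?thesis by simp
qed

definition state_const :: "nat \<Rightarrow> real" where
  "state_const r = 2 * 7 ^ r * (4 * real r) ^ (r + 1)"

lemma state_const_nonneg: "0 \<le> state_const r"
  by (simp add: state_const_def)

definition root_const :: "nat \<Rightarrow> real" where
  "root_const r = (16 * real r) ^ r * (2 * real r) ^ r * state_const r"

context singular_pair
begin

lemma overflow_L2_real:
  assumes "1 < x" "x \<le> 1 + c"
  shows "L2_set (\<lambda>n. norm (poly (overflow r c v u n) (of_real x))) {..N} \<le> 2 * c ^ r / (x - 1)"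
proof -
  let ?V = "\<lambda>n. norm (poly (gen_poly v n) (of_real x)) / x ^ n"
  let ?U = "\<lambda>n. norm (poly (gen_poly u n) (of_real x)) / x ^ n"
  have pw: "norm (poly (overflow r c v u n) (of_real x)) \<le> c ^ r * (?V n + ?U n)" if "n \<le> N" for n
  proof -
    have one: "norm (1 - complex_of_real x) ^ r \<le> c ^ r"
    proof (rule power_mono)
      have "1 - complex_of_real x = of_real (1 - x)" by simp
      hence "norm (1 - complex_of_real x) = \<bar>1 - x\<bar>" by (simp only: norm_of_real)
      thus "norm (1 - complex_of_real x) \<le> c" using assms by simp
    qed simp
    have "x ^ n * norm (poly (overflow r c v u n) (of_real x))
        = norm (of_real x ^ n * poly (overflow r c v u n) (of_real x))"
      using assms(1) by (simp add: norm_mult norm_power)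
    also have "\<dots> \<le> norm ((1 - of_real x) ^ r * poly (gen_poly v n) (of_real x))
        + norm (complex_of_real (c ^ r) * poly (gen_poly u n) (of_real x))"
      unfolding overflow_eval[OF that] by (rule norm_triangle_ineq4)
    also have "\<dots> = norm (1 - complex_of_real x) ^ r * norm (poly (gen_poly v n) (of_real x))
        + c ^ r * norm (poly (gen_poly u n) (of_real x))"
      using c_pos by (simp add: norm_mult norm_power)
    also have "\<dots> \<le> c ^ r * norm (poly (gen_poly v n) (of_real x)) + c ^ r * norm (poly (gen_poly u n) (of_real x))"
      using one by (intro add_right_mono mult_right_mono) auto
    also have "\<dots> = x ^ n * (c ^ r * (?V n + ?U n))"
      using assms(1) by (simp add: field_simps)
    finally show ?thesis using assms(1) by simp
  qed
  have "L2_set (\<lambda>n. norm (poly (overflow r c v u n) (of_real x))) {..N} \<le> L2_set (\<lambda>n. c ^ r * (?V n + ?U n)) {..N}"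
    by (rule L2_set_mono) (use pw in auto)
  also have "\<dots> = c ^ r * L2_set (\<lambda>n. ?V n + ?U n) {..N}"
    using c_pos by (intro L2_set_right_distrib[symmetric]) simp
  also have "\<dots> \<le> c ^ r * (L2_set ?V {..N} + L2_set ?U {..N})"
    using c_pos by (intro mult_left_mono L2_set_triangle_ineq) simp
  also have "\<dots> \<le> c ^ r * (1 / (x - 1) + 1 / (x - 1))"
    using c_pos by (intro mult_left_mono add_mono discounted_sum_L2 assms norm_u norm_v) simp
  finally show ?thesis by (simp add: mult.commute)
qed

text \<open>Direct estimation fails for roots with \<open>\<bar>z\<bar> \<le> 1\<close>, where the discounting goes the wrong way. The
value at \<open>z\<close> is therefore interpolated from the \<open>r\<close> real points \<open>1 + c l / r\<close> with \<open>1 \<le> l \<le> r\<close>.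
They have the right scale, since \<open>1 - z\<close> is also of order \<open>c\<close>.\<close>

lemma overflow_L2_root:
  assumes z: "z \<in> char_roots r c"
  shows "L2_set (\<lambda>n. norm (poly (overflow r c v u n) z)) {..N} \<le> (4 * real r) ^ (r + 1) * c ^ (r - 1)"
proof -
  define node where "node l = 1 + c * (real l + 1) / real r" for l :: nat
  define A where "A = (\<lambda>l. complex_of_real (node l)) ` {..<r}"
  have dist: "norm (complex_of_real (node k) - of_real (node l)) = c / real r * \<bar>real k - real l\<bar>" for k l
  proof -
    have "node k - node l = c / real r * (real k - real l)"
      using r_pos by (simp add: node_def field_simps)
    moreover have "complex_of_real (node k) - of_real (node l) = of_real (node k - node l)" by simp
    ultimately have "norm (complex_of_real (node k) - of_real (node l)) = \<bar>c / real r * (real k - real l)\<bar>"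
      by (simp only: norm_of_real)
    thus ?thesis using c_pos by (simp add: abs_mult)
  qed
  have inj: "inj_on (\<lambda>l. complex_of_real (node l)) {..<r}"
    using c_pos r_pos by (auto simp: inj_on_def node_def)
  have A: "finite A" "card A = r" using inj by (auto simp: A_def card_image)
  have node: "1 < node l" "node l \<le> 1 + c" "c / real r \<le> node l - 1" if "l < r" for l
  proof -
    show "1 < node l" using c_pos r_pos by (simp add: node_def add_pos_nonneg)
    have "c * (real l + 1) \<le> c * real r" using that c_pos by (intro mult_left_mono) auto
    thus "node l \<le> 1 + c" using r_pos by (simp add: node_def field_simps)
    have "c * 1 \<le> c * (real l + 1)" using c_pos by (intro mult_left_mono) auto
    thus "c / real r \<le> node l - 1" using r_pos by (simp add: node_def divide_right_mono)
  qed
  have pw: "norm (poly (overflow r c v u n) z)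
      \<le> (4 * real r) ^ (r - 1) * (\<Sum>a\<in>A. norm (poly (overflow r c v u n) a))" for n
  proof -
    have "norm (poly (overflow r c v u n) z)
      \<le> (4 * real r) ^ (card A - 1) * (\<Sum>a\<in>A. norm (poly (overflow r c v u n) a))"
    proof (rule norm_poly_le_by_interpolation[of A _ "c / real r"])
      show "degree (overflow r c v u n) < card A" using degree_overflow[OF r_pos] A by simp
      show "c / real r \<le> norm (a - b)" if "a \<in> A" "b \<in> A" "a \<noteq> b" for a b
      proof -
        from that obtain k l where kl: "a = of_real (node k)" "b = of_real (node l)" "k \<noteq> l"
          by (auto simp: A_def)
        have "1 \<le> \<bar>real k - real l\<bar>" using kl(3) by linarith
        hence "c / real r * 1 \<le> c / real r * \<bar>real k - real l\<bar>"
          using c_pos by (intro mult_left_mono) auto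
        thus ?thesis unfolding kl dist by simp
      qed
      show "norm (z - a) \<le> 4 * real r * (c / real r)" if "a \<in> A" for a
      proof -
        from that obtain l where l: "a = of_real (node l)" "l < r" by (auto simp: A_def)
        have "norm (1 - a) = \<bar>1 - node l\<bar>"
        proof -
          have "1 - a = of_real (1 - node l)" by (simp add: l)
          thus ?thesis by (simp only: norm_of_real)
        qed
        hence "norm (1 - a) \<le> c" using node[OF l(2)] by simp
        moreover have "norm (1 - z) \<le> 3 * c" by (rule norm_one_minus_root_le[OF z r_pos c_pos c_less])
        moreover have "norm (z - a) \<le> norm (1 - a) + norm (1 - z)"
          using norm_triangle_ineq4[of "1 - a" "1 - z"] by simp
        ultimately show ?thesis using r_pos by simp
      qed
    qed (use A c_pos r_pos in auto)
    thus ?thesis by (simp only: A)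
  qed
  have "L2_set (\<lambda>n. norm (poly (overflow r c v u n) z)) {..N}
      \<le> L2_set (\<lambda>n. (4 * real r) ^ (r - 1) * (\<Sum>a\<in>A. norm (poly (overflow r c v u n) a))) {..N}"
    by (rule L2_set_mono) (use pw in auto)
  also have "\<dots> = (4 * real r) ^ (r - 1) * L2_set (\<lambda>n. \<Sum>a\<in>A. norm (poly (overflow r c v u n) a)) {..N}"
    by (intro L2_set_right_distrib[symmetric]) simp
  also have "\<dots> \<le> (4 * real r) ^ (r - 1) * (\<Sum>a\<in>A. L2_set (\<lambda>n. norm (poly (overflow r c v u n) a)) {..N})"
    using A by (intro mult_left_mono L2_set_sum_le) auto
  also have "\<dots> \<le> (4 * real r) ^ (r - 1) * (\<Sum>a\<in>A. 2 * c ^ r / (c / real r))"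
  proof (intro mult_left_mono sum_mono)
    fix a assume "a \<in> A"
    then obtain l where l: "a = of_real (node l)" "l < r" by (auto simp: A_def)
    have "L2_set (\<lambda>n. norm (poly (overflow r c v u n) a)) {..N} \<le> 2 * c ^ r / (node l - 1)"
      unfolding l(1) by (rule overflow_L2_real) (use node[OF l(2)] in auto)
    also have "\<dots> \<le> 2 * c ^ r / (c / real r)"
      using node[OF l(2)] c_pos r_pos by (intro divide_left_mono) auto
    finally show "L2_set (\<lambda>n. norm (poly (overflow r c v u n) a)) {..N} \<le> 2 * c ^ r / (c / real r)" .
  qed simp
  also have "\<dots> = (4 * real r) ^ (r - 1) * (2 * real r * real r) * c ^ (r - 1)"
  proof -
    have "c ^ r = c * c ^ (r - 1)" using r_pos by (simp add: power_eq_if)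
    thus ?thesis using A c_pos by (simp add: field_simps)
  qed
  also have "\<dots> \<le> (4 * real r) ^ (r - 1) * ((4 * real r) * (4 * real r)) * c ^ (r - 1)"
    using c_pos by (intro mult_right_mono mult_left_mono) auto
  also have "(4 * real r) ^ (r - 1) * ((4 * real r) * (4 * real r)) = (4 * real r) ^ (r + 1)"
  proof -
    have "r + 1 = (r - 1) + 2" using r_pos by simp
    thus ?thesis by (simp only: power_add power2_eq_square)
  qed
  finally show ?thesis .
qed

lemma state_L2:
  assumes z: "z \<in> char_roots r c"
  shows "L2_set (\<lambda>n. norm (state n z)) {..N} \<le> state_const r * c ^ r * c ^ (r - 1)"
proof -
  interpret rev: singular_pair N r c "reversed N u" "reversed N v"
    by (rule singular_pair_reversed) (rule singular_pair_axioms)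
  let ?P = "\<lambda>n. norm (poly (overflow r c v u n) z)" and ?T = "\<lambda>n. norm (poly (tail_overflow n) (1 / z))"
  let ?B = "(4 * real r) ^ (r + 1) * c ^ (r - 1)"
  have P: "L2_set ?P {..N} \<le> ?B" by (rule overflow_L2_root[OF z])
  have T: "L2_set ?T {..N} \<le> ?B"
  proof -
    have "(\<Sum>n\<le>N. (?T n)\<^sup>2) = (\<Sum>n\<le>N. (norm (poly (overflow r c (reversed N u) (reversed N v) n) (1 / z)))\<^sup>2)"
      by (rule sum.reindex_bij_witness[of _ "\<lambda>n. N - n" "\<lambda>n. N - n"]) (auto simp: tail_overflow_def)
    thus ?thesis using rev.overflow_L2_root[OF inverse_in_char_roots[OF z]] by (simp add: L2_set_def)
  qed
  have "norm (state n z) \<le> 7 ^ r * c ^ r * (?T n + ?P n)" for n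
  proof -
    have "norm (state n z) \<le> norm ((1 - z) ^ r * poly (tail_overflow n) (1 / z))
        + norm (of_real (c ^ r) * z * poly (overflow r c v u n) z)"
      unfolding state_def by (rule norm_triangle_ineq4)
    also have "\<dots> = norm (1 - z) ^ r * ?T n + (norm z * c ^ r) * ?P n"
      using c_pos by (simp add: norm_mult norm_power)
    also have "\<dots> \<le> (7 ^ r * c ^ r) * ?T n + (7 ^ r * c ^ r) * ?P n"
    proof (intro add_mono mult_right_mono)
      show "norm (1 - z) ^ r \<le> 7 ^ r * c ^ r"
        by (rule norm_one_minus_root_power[OF z r_pos c_pos c_less])
      have "(7::real) ^ 1 \<le> 7 ^ r" using r_pos by (intro power_increasing) auto
      thus "norm z \<le> 7 ^ r" using norm_root_le[OF z r_pos c_pos c_less] by simp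
    qed (use c_pos in auto)
    finally show ?thesis by (simp only: distrib_left)
  qed
  hence "L2_set (\<lambda>n. norm (state n z)) {..N} \<le> L2_set (\<lambda>n. 7 ^ r * c ^ r * (?T n + ?P n)) {..N}"
    by (intro L2_set_mono) auto
  also have "\<dots> = 7 ^ r * c ^ r * L2_set (\<lambda>n. ?T n + ?P n) {..N}"
    using c_pos by (intro L2_set_right_distrib[symmetric]) simp
  also have "\<dots> \<le> 7 ^ r * c ^ r * (L2_set ?T {..N} + L2_set ?P {..N})"
    using c_pos by (intro mult_left_mono L2_set_triangle_ineq) simp
  also have "\<dots> \<le> 7 ^ r * c ^ r * (?B + ?B)"
    using c_pos by (intro mult_left_mono add_mono P T) simp
  also have "\<dots> = state_const r * c ^ r * c ^ (r - 1)"
    by (simp add: state_const_def)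
  finally show ?thesis .
qed

text \<open>The conserved product equals its mean over the \<open>N + 1\<close> positions.\<close>

lemma overflow_product_bound:
  assumes z: "z \<in> char_roots r c"
  shows "norm (poly (overflow r c v u N) z * poly (overflow r c v u N) (1 / z))
    \<le> (state_const r * c ^ (r - 1))\<^sup>2 / real N"
proof -
  let ?X = "norm (poly (overflow r c v u N) z * poly (overflow r c v u N) (1 / z))"
  let ?B = "state_const r * c ^ (r - 1)"
  have "real (Suc N) * ((c ^ r)\<^sup>2 * ?X) = (\<Sum>n\<le>N. (c ^ r)\<^sup>2 * ?X)" by simp
  also have "\<dots> = (\<Sum>n\<le>N. \<bar>norm (state n z)\<bar> * \<bar>norm (state n (1 / z))\<bar>)"
  proof (rule sum.cong)
    fix n assume "n \<in> {..N}"
    hence "norm (of_real (c ^ (2 * r)) * (poly (overflow r c v u N) z * poly (overflow r c v u N) (1 / z)))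
      = norm (state n z * state n (1 / z))" using state_product[OF z] by simp
    moreover have "norm (complex_of_real (c ^ (2 * r))) = (c ^ r)\<^sup>2"
      using c_pos by (simp add: power_mult[symmetric] mult.commute norm_power)
    ultimately show "(c ^ r)\<^sup>2 * ?X = \<bar>norm (state n z)\<bar> * \<bar>norm (state n (1 / z))\<bar>"
      by (simp only: norm_mult abs_norm_cancel)
  qed simp
  also have "\<dots> \<le> L2_set (\<lambda>n. norm (state n z)) {..N} * L2_set (\<lambda>n. norm (state n (1 / z))) {..N}"
    by (rule L2_set_mult_ineq)
  also have "\<dots> \<le> (state_const r * c ^ r * c ^ (r - 1)) * (state_const r * c ^ r * c ^ (r - 1))"
    using c_pos state_const_nonneg[of r]
    by (intro mult_mono state_L2 z inverse_in_char_roots L2_set_nonneg) auto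
  also have "\<dots> = (c ^ r)\<^sup>2 * ?B\<^sup>2" by (simp add: power2_eq_square)
  finally have "(c ^ r)\<^sup>2 * (real (Suc N) * ?X) \<le> (c ^ r)\<^sup>2 * ?B\<^sup>2" by (simp only: mult.left_commute)
  moreover have "0 < (c ^ r)\<^sup>2" using c_pos by simp
  ultimately have "real (Suc N) * ?X \<le> ?B\<^sup>2" by (simp only: mult_le_cancel_left_pos)
  moreover have "real N * ?X \<le> real (Suc N) * ?X" by (intro mult_right_mono) auto
  ultimately show ?thesis using N_pos by (simp add: pos_le_divide_eq mult.commute)
qed

text \<open>On the arc, \<open>2 - z - 1/z\<close> is a number of \<open>[0, c\<^sup>2]\<close>. There \<open>\<bar>p\<^sub>N\<bar>\<^sup>2\<close> is interpolated from the \<open>r\<close>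
values of \<open>2 - z - 1/z\<close> at the roots, where the product bound applies.\<close>

lemma overflow_arc_bound:
  assumes nz: "norm z = 1" and near: "norm (1 - z) \<le> c"
  shows "norm (poly (overflow r c v u N) z) \<le> (2 * real r) ^ r * (state_const r * c ^ (r - 1)) / sqrt (real N)"
proof -
  let ?p = "overflow r c v u N" and ?B = "state_const r * c ^ (r - 1)"
  obtain \<kappa> where k: "degree \<kappa> \<le> degree ?p"
    "\<And>w. w \<noteq> 0 \<Longrightarrow> poly ?p w * poly ?p (1 / w) = poly \<kappa> (2 - w - 1 / w)"
    using exists_modulus_poly by metis
  \<comment> \<open>the values of \<open>2 - w - 1/w\<close> at the roots \<open>w\<close>\<close>
  define Y where "Y = {y :: complex. y ^ r = of_real (c ^ (2 * r))}"
  define y where "y = 2 - z - 1 / z"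
  have z: "z \<noteq> 0" using nz by auto
  have cY: "card Y = r" unfolding Y_def using c_pos r_pos by (intro card_nth_roots) auto
  have fY: "finite Y" by (rule card_ge_0_finite) (simp add: cY r_pos)
  have nY: "norm a = c\<^sup>2" if "a \<in> Y" for a
  proof -
    have "a ^ r = of_real (c ^ (2 * r))" using that unfolding Y_def by blast
    from exists_char_root[OF this] obtain w where "w \<in> char_roots r c" "2 - w - 1 / w = a" .
    thus ?thesis using norm_symbol[OF _ r_pos c_pos] by blast
  qed
  have ny: "norm y \<le> c\<^sup>2"
  proof -
    have "norm (y * z) = norm (- ((1 - z)\<^sup>2))"
      unfolding y_def by (rule arg_cong[of _ _ norm]) (rule symbol_mult[OF z])
    hence "norm y = (norm (1 - z))\<^sup>2" by (simp add: norm_mult norm_power nz)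
    thus ?thesis using near by (simp add: power_mono)
  qed
  have "norm (poly \<kappa> y) \<le> (2 * real r) ^ (card Y - 1) * (\<Sum>a\<in>Y. norm (poly \<kappa> a))"
  proof (rule norm_poly_le_by_interpolation[OF fY, of _ "c\<^sup>2 / real r"])
    show "degree \<kappa> < card Y" using k(1) degree_overflow[OF r_pos, of c v u N] cY by simp
    show "c\<^sup>2 / real r \<le> norm (a - b)" if "a \<in> Y" "b \<in> Y" "a \<noteq> b" for a b
    proof -
      have "norm a \<le> real r * norm (a - b)"
        by (rule equal_powers_separated[OF r_pos]) (use that in \<open>auto simp: Y_def\<close>)
      thus ?thesis using nY[OF that(1)] r_pos by (simp add: pos_divide_le_eq mult.commute)
    qed
    show "norm (y - a) \<le> 2 * real r * (c\<^sup>2 / real r)" if "a \<in> Y" for a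
      using norm_triangle_ineq4[of y a] ny nY[OF that] r_pos by simp
  qed (use c_pos r_pos in auto)
  also have "\<dots> \<le> (2 * real r) ^ (card Y - 1) * (\<Sum>a\<in>Y. ?B\<^sup>2 / real N)"
  proof (intro mult_left_mono sum_mono)
    fix a assume "a \<in> Y"
    then obtain w where w: "w \<in> char_roots r c" "2 - w - 1 / w = a"
      using exists_char_root[of a r c] by (auto simp: Y_def)
    have "w \<noteq> 0" using w(1) by (simp add: char_roots_def)
    thus "norm (poly \<kappa> a) \<le> ?B\<^sup>2 / real N"
      using overflow_product_bound[OF w(1)] k(2)[of w] w(2) by simp
  qed simp
  also have "\<dots> = (2 * real r) ^ (r - 1) * real r * (?B\<^sup>2 / real N)" by (simp add: cY)
  also have "\<dots> \<le> ((2 * real r) ^ r)\<^sup>2 * (?B\<^sup>2 / real N)"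
  proof (rule mult_right_mono)
    have "(2 * real r) ^ (r - 1) * real r \<le> (2 * real r) ^ (r - 1) * (2 * real r)"
      by (intro mult_left_mono) auto
    also have "\<dots> = (2 * real r) ^ r" using r_pos by (simp add: power_eq_if)
    also have "\<dots> \<le> ((2 * real r) ^ r)\<^sup>2" using r_pos by (intro self_le_power one_le_power) auto
    finally show "(2 * real r) ^ (r - 1) * real r \<le> ((2 * real r) ^ r)\<^sup>2" .
  qed simp
  finally have "norm (poly \<kappa> y) \<le> ((2 * real r) ^ r * ?B / sqrt (real N))\<^sup>2"
    by (simp add: power_mult_distrib power_divide)
  moreover have "norm (poly \<kappa> y) = (norm (poly ?p z))\<^sup>2"
    unfolding y_def k(2)[OF z, symmetric] overflow_cnj[OF nz] by (simp add: norm_mult power2_eq_square)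
  ultimately have "(norm (poly ?p z))\<^sup>2 \<le> ((2 * real r) ^ r * ?B / sqrt (real N))\<^sup>2" by simp
  from power2_le_imp_le[OF this] show ?thesis using c_pos state_const_nonneg[of r] by simp
qed

text \<open>The nodes are the Cayley transforms \<open>(1 + \<i> t) / (1 - \<i> t)\<close> of equidistant \<open>t\<close> in \<open>[0, c/2)\<close>. They
lie on the arc, and their distances are explicit rational functions of the \<open>t\<close>.\<close>

lemma overflow_root_bound:
  assumes z: "z \<in> char_roots r c"
  shows "norm (poly (overflow r c v u N) z) \<le> root_const r * c ^ (r - 1) / sqrt (real N)"
proof -
  let ?p = "overflow r c v u N"
  let ?B = "(2 * real r) ^ r * (state_const r * c ^ (r - 1)) / sqrt (real N)"
  have B0: "0 \<le> ?B" using c_pos state_const_nonneg[of r] by simp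
  define t where "t l = c * real l / (2 * real r)" for l :: nat
  define node where "node l = (1 + \<i> * of_real (t l)) / (1 - \<i> * of_real (t l))" for l
  have t: "0 \<le> t l" "t l \<le> c / 2" if "l < r" for l
  proof -
    show "0 \<le> t l" using c_pos by (simp add: t_def)
    have "c * real l \<le> c * real r" using that c_pos by (intro mult_left_mono) auto
    thus "t l \<le> c / 2" using r_pos by (simp add: t_def field_simps)
  qed
  have ne: "1 - \<i> * of_real s \<noteq> 0" for s :: real by (simp add: complex_eq_iff)
  have ge1: "1 \<le> norm (1 - \<i> * of_real s)" for s :: real
    by (simp add: cmod_def)
  have le2: "norm (1 - \<i> * of_real s) \<le> 2" if "0 \<le> s" "s \<le> 1" for s :: real
    using norm_triangle_ineq4[of 1 "\<i> * of_real s"] that by (simp add: norm_mult)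
  have unit: "norm (node l) = 1" for l
  proof -
    have "norm (1 + \<i> * of_real (t l)) = norm (1 - \<i> * of_real (t l))" by (simp add: cmod_def)
    thus ?thesis using ne[of "t l"] by (simp add: node_def norm_divide)
  qed
  have near: "norm (1 - node l) \<le> c" if "l < r" for l
  proof -
    have "1 - node l = - 2 * \<i> * of_real (t l) / (1 - \<i> * of_real (t l))"
      using ne[of "t l"] by (simp add: node_def field_simps)
    hence "norm (1 - node l) = 2 * t l / norm (1 - \<i> * of_real (t l))"
      using t[OF that] by (simp add: norm_divide norm_mult)
    also have "\<dots> \<le> 2 * t l / 1" using t[OF that] ge1[of "t l"] by (intro divide_left_mono) auto
    finally show ?thesis using t[OF that] by simp
  qed
  have sep: "c / (4 * real r) \<le> norm (node k - node l)" if "k < r" "l < r" "k \<noteq> l" for k l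
  proof -
    have "node k - node l = 2 * \<i> * of_real (t k - t l) / ((1 - \<i> * of_real (t k)) * (1 - \<i> * of_real (t l)))"
      using ne[of "t k"] ne[of "t l"] by (simp add: node_def field_simps)
    hence "norm (node k - node l) = norm (2 * \<i> * of_real (t k - t l)) / (norm (1 - \<i> * of_real (t k)) * norm (1 - \<i> * of_real (t l)))"
      by (simp only: norm_divide norm_mult)
    also have "norm (2 * \<i> * of_real (t k - t l)) = 2 * \<bar>t k - t l\<bar>"
      by (simp only: norm_mult norm_of_real norm_ii norm_numeral mult_1_right)
    finally have eq: "norm (node k - node l) = 2 * \<bar>t k - t l\<bar> / (norm (1 - \<i> * of_real (t k)) * norm (1 - \<i> * of_real (t l)))" .
    have "1 \<le> \<bar>real k - real l\<bar>" using that(3) by linarith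
    hence "c / (2 * real r) * 1 \<le> c / (2 * real r) * \<bar>real k - real l\<bar>"
      using c_pos by (intro mult_left_mono) auto
    also have "\<dots> = \<bar>c / (2 * real r) * (real k - real l)\<bar>" using c_pos by (simp add: abs_mult)
    also have "c / (2 * real r) * (real k - real l) = t k - t l" by (simp add: t_def field_simps diff_divide_distrib)
    finally have gap: "c / (2 * real r) \<le> \<bar>t k - t l\<bar>" by simp
    have "norm (1 - \<i> * of_real (t k)) * norm (1 - \<i> * of_real (t l)) \<le> 2 * 2"
      using t[OF that(1)] t[OF that(2)] c_less by (intro mult_mono le2) auto
    hence "2 * \<bar>t k - t l\<bar> / 4 \<le> norm (node k - node l)"
      unfolding eq using ge1[of "t k"] ge1[of "t l"]
      by (intro divide_left_mono mult_pos_pos) auto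
    thus ?thesis using gap by simp
  qed
  define A where "A = node ` {..<r}"
  have "inj_on node {..<r}"
  proof (rule inj_onI, rule ccontr)
    fix k l assume kl: "k \<in> {..<r}" "l \<in> {..<r}" "node k = node l" "k \<noteq> l"
    hence "c / (4 * real r) \<le> 0" using sep[of k l] by simp
    moreover have "0 < c / (4 * real r)" using c_pos r_pos by simp
    ultimately show False by linarith
  qed
  hence A: "finite A" "card A = r" by (auto simp: A_def card_image)
  have "norm (poly ?p z) \<le> (16 * real r) ^ (card A - 1) * (\<Sum>a\<in>A. norm (poly ?p a))"
  proof (rule norm_poly_le_by_interpolation[of A _ "c / (4 * real r)"])
    show "degree ?p < card A" using degree_overflow[OF r_pos] A by simp
    show "c / (4 * real r) \<le> norm (a - b)" if "a \<in> A" "b \<in> A" "a \<noteq> b" for a b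
      using that sep by (auto simp: A_def)
    show "norm (z - a) \<le> 16 * real r * (c / (4 * real r))" if "a \<in> A" for a
    proof -
      have "norm (1 - a) \<le> c" using that near by (auto simp: A_def)
      moreover have "norm (1 - z) \<le> 3 * c" by (rule norm_one_minus_root_le[OF z r_pos c_pos c_less])
      moreover have "norm (z - a) \<le> norm (1 - a) + norm (1 - z)"
        using norm_triangle_ineq4[of "1 - a" "1 - z"] by simp
      ultimately show ?thesis using r_pos by simp
    qed
  qed (use A c_pos r_pos in auto)
  also have "\<dots> \<le> (16 * real r) ^ (card A - 1) * (\<Sum>a\<in>A. ?B)"
  proof (intro mult_left_mono sum_mono)
    fix a assume "a \<in> A"
    thus "norm (poly ?p a) \<le> ?B" using overflow_arc_bound unit near by (auto simp: A_def)
  qed simp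
  also have "\<dots> = ((16 * real r) ^ (r - 1) * real r) * ?B" by (simp add: A)
  also have "\<dots> \<le> (16 * real r) ^ r * ?B"
  proof (rule mult_right_mono[OF _ B0])
    have "(16 * real r) ^ (r - 1) * real r \<le> (16 * real r) ^ (r - 1) * (16 * real r)"
      by (intro mult_left_mono) auto
    also have "\<dots> = (16 * real r) ^ r" using r_pos by (simp add: power_eq_if)
    finally show "(16 * real r) ^ (r - 1) * real r \<le> (16 * real r) ^ r" .
  qed
  also have "\<dots> = root_const r * c ^ (r - 1) / sqrt (real N)" by (simp add: root_const_def)
  finally show ?thesis .
qed

text \<open>By conservation the state at \<open>n\<close> is \<open>z\<^sup>N\<^sup>-\<^sup>n\<close> times the state at \<open>N\<close> and \<open>z\<^sup>-\<^sup>n\<close> times the state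
at \<open>0\<close>. The first form is used for \<open>\<bar>z\<bar> \<le> 1\<close> and the second one otherwise, so the power of \<open>z\<close>
never exceeds \<open>1\<close> in modulus.\<close>

lemma state_bound:
  assumes z: "z \<in> char_roots r c" and n: "n \<le> N"
  shows "norm (state n z) \<le> 7 ^ r * c ^ r * (root_const r * c ^ (r - 1) / sqrt (real N))"
proof -
  interpret rev: singular_pair N r c "reversed N u" "reversed N v"
    by (rule singular_pair_reversed) (rule singular_pair_axioms)
  let ?B = "root_const r * c ^ (r - 1) / sqrt (real N)"
  have z0: "z \<noteq> 0" using z by (simp add: char_roots_def)
  show ?thesis
  proof (cases "norm z \<le> 1")
    case True
    have "z ^ n * state n z = z ^ N * state N z"
      using state_conserved[OF z n] state_conserved[OF z order.refl] by simp
    also have "z ^ N = z ^ n * z ^ (N - n)" using n by (simp flip: power_add)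
    finally have "state n z = z ^ (N - n) * state N z" using z0 by simp
    hence "norm (state n z) = norm z ^ (N - n) * (c ^ r * norm z * norm (poly (overflow r c v u N) z))"
      unfolding state_N using c_pos by (simp add: norm_mult norm_power)
    also have "\<dots> \<le> 1 * (c ^ r * 1 * ?B)"
      using True c_pos by (intro mult_mono power_le_one overflow_root_bound z) auto
    also have "\<dots> \<le> 7 ^ r * (c ^ r * 1 * ?B)"
    proof (rule mult_right_mono)
      have "0 \<le> ?B" using order_trans[OF norm_ge_zero overflow_root_bound[OF z]] .
      moreover have "0 \<le> c ^ r * 1" using c_pos by simp
      ultimately show "0 \<le> c ^ r * 1 * ?B" by (rule mult_nonneg_nonneg[rotated])
    qed simp
    finally show ?thesis by simp
  next
    case False
    have "z ^ n * state n z = state 0 z"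
      using state_conserved[OF z n] state_0 by simp
    hence "norm z ^ n * norm (state n z) = norm (state 0 z)" by (metis norm_mult norm_power)
    moreover have "1 * norm (state n z) \<le> norm z ^ n * norm (state n z)"
      using False by (intro mult_right_mono one_le_power) auto
    ultimately have "norm (state n z) \<le> norm (state 0 z)" by simp
    also have "\<dots> = norm (1 - z) ^ r * norm (poly (overflow r c (reversed N u) (reversed N v) N) (1 / z))"
      unfolding state_0 tail_overflow_def by (simp add: norm_mult norm_power)
    also have "\<dots> \<le> (7 ^ r * c ^ r) * ?B"
      using c_pos
      by (intro mult_mono norm_one_minus_root_power[OF z r_pos c_pos c_less]
          rev.overflow_root_bound inverse_in_char_roots z) auto
    finally show ?thesis .
  qed
qed

end

section \<open>From the state to the entries of a singular vector\<close>

text \<open>A combination of the modes \<open>z\<^sup>-\<^sup>n\<close> and \<open>z\<^sup>n\<close> with \<open>\<bar>z\<bar> = 1\<close> cannot concentrate, however close the two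
are to each other: \<open>g\<^sub>n\<close> is bounded by \<open>2 \<bar>g\<^sub>n\<^sub>+\<^sub>q\<bar> + \<bar>g\<^sub>n\<^sub>+\<^sub>2\<^sub>q\<bar>\<close> for every step \<open>q\<close>, and likewise with
backward steps. Summing the squares over all \<open>q\<close> up to \<open>N/4\<close> uses every index at most once in
each of the two terms.\<close>

lemma oscillation_bound:
  fixes g :: "nat \<Rightarrow> complex" and \<alpha> :: "complex \<Rightarrow> complex"
  assumes fin: "finite Z" and unit: "\<And>z. z \<in> Z \<Longrightarrow> norm z = 1"
    and sym: "\<And>z w. z \<in> Z \<Longrightarrow> w \<in> Z \<Longrightarrow> 2 - z - 1 / z = 2 - w - 1 / w"
    and g: "\<And>n. g n = (\<Sum>z\<in>Z. \<alpha> z * (1 / z) ^ n)"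
    and L2: "L2_set (\<lambda>n. norm (g n)) {1..N} \<le> G"
    and N: "4 \<le> N" and n: "1 \<le> n" "n \<le> N"
  shows "norm (g n) \<le> 9 * G / sqrt (real N)"
proof -
  \<comment> \<open>for every \<open>n\<close> there is room for two steps of any length up to \<open>m\<close>, either forward or backward\<close>
  define m where "m = N div 4"
  have m: "1 \<le> m" "4 * m \<le> N" "N \<le> 8 * m" using N unfolding m_def by presburger+
  have step: "\<exists>k. norm k \<le> 2 \<and> (\<forall>i. g i = k * g (i + q) - g (i + 2 * q) \<and> g (i + 2 * q) = k * g (i + q) - g i)" for q
  proof (cases "Z = {}")
    case True
    thus ?thesis by (intro exI[of _ 0]) (simp add: g)
  next
    case False
    then obtain z0 where z0: "z0 \<in> Z" by blast
    obtain \<tau> :: "complex poly" where tau: "\<And>z. z \<noteq> 0 \<Longrightarrow> z ^ q + (1 / z) ^ q = poly \<tau> (2 - z - 1 / z)"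
      using exists_power_sum_poly[of q] by blast
    let ?k = "poly \<tau> (2 - z0 - 1 / z0)"
    have nz: "z \<noteq> 0" if "z \<in> Z" for z using unit[OF that] by auto
    have k: "z ^ q + (1 / z) ^ q = ?k" if "z \<in> Z" for z
      using tau[OF nz[OF that]] sym[OF that z0] by (simp only:)
    have "norm ?k \<le> norm (z0 ^ q) + norm ((1 / z0) ^ q)"
      unfolding k[OF z0, symmetric] by (rule norm_triangle_ineq)
    hence "norm ?k \<le> 2" using unit[OF z0] by (simp add: norm_power norm_divide)
    moreover have "g i + g (i + 2 * q) = ?k * g (i + q)" for i
    proof -
      have "?k * g (i + q) = (\<Sum>z\<in>Z. \<alpha> z * (1 / z) ^ i + \<alpha> z * (1 / z) ^ (i + 2 * q))"
        unfolding g sum_distrib_left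
      proof (rule sum.cong)
        fix z assume "z \<in> Z"
        have "z ^ q * (1 / z) ^ q = 1" using nz[OF \<open>z \<in> Z\<close>] by (simp add: power_one_over)
        have "?k * (\<alpha> z * (1 / z) ^ (i + q))
            = \<alpha> z * (1 / z) ^ i * ((z ^ q * (1 / z) ^ q) + (1 / z) ^ q * (1 / z) ^ q)"
          unfolding k[OF \<open>z \<in> Z\<close>, symmetric] power_add by (simp only: algebra_simps)
        also have "\<dots> = \<alpha> z * (1 / z) ^ i + \<alpha> z * (1 / z) ^ (i + 2 * q)"
          unfolding \<open>z ^ q * (1 / z) ^ q = 1\<close> power_add mult_2
            by (simp only: algebra_simps mult_1_left mult_1_right)
        finally show "?k * (\<alpha> z * (1 / z) ^ (i + q)) = \<alpha> z * (1 / z) ^ i + \<alpha> z * (1 / z) ^ (i + 2 * q)" .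
      qed simp
      thus ?thesis by (simp add: g sum.distrib)
    qed
    ultimately show ?thesis
      by (intro exI[of _ ?k]) (auto simp: algebra_simps eq_diff_eq)
  qed
  have sq: "(norm (k * a - b))\<^sup>2 \<le> 8 * (norm a)\<^sup>2 + 2 * (norm b)\<^sup>2" if "norm k \<le> 2" for k a b :: complex
  proof -
    have "norm (k * a - b) \<le> norm (k * a) + norm b" by (rule norm_triangle_ineq4)
    also have "norm (k * a) \<le> 2 * norm a" unfolding norm_mult using that by (intro mult_right_mono) auto
    finally have "(norm (k * a - b))\<^sup>2 \<le> (2 * norm a + norm b)\<^sup>2" by (intro power_mono) auto
    also have "\<dots> \<le> 8 * (norm a)\<^sup>2 + 2 * (norm b)\<^sup>2"
      using zero_le_power2[of "2 * norm a - norm b"] by (simp add: power2_eq_square algebra_simps)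
    finally show ?thesis .
  qed
  define S where "S = (\<Sum>i\<in>{1..N}. (norm (g i))\<^sup>2)"
  have sub: "(\<Sum>q\<in>{1..m}. (norm (g (f q)))\<^sup>2) \<le> S" if "inj_on f {1..m}" "f ` {1..m} \<subseteq> {1..N}" for f
  proof -
    have "(\<Sum>q\<in>{1..m}. (norm (g (f q)))\<^sup>2) = (\<Sum>i\<in>f ` {1..m}. (norm (g i))\<^sup>2)"
      by (subst sum.reindex[OF that(1)]) (simp add: o_def)
    also have "\<dots> \<le> S" unfolding S_def using that(2) by (intro sum_mono2) auto
    finally show ?thesis .
  qed
  have "\<exists>f h. inj_on f {1..m} \<and> f ` {1..m} \<subseteq> {1..N} \<and> inj_on h {1..m} \<and> h ` {1..m} \<subseteq> {1..N}
      \<and> (\<forall>q\<in>{1..m}. (norm (g n))\<^sup>2 \<le> 8 * (norm (g (f q)))\<^sup>2 + 2 * (norm (g (h q)))\<^sup>2)"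
  proof (cases "n + 2 * m \<le> N")
    case True
    show ?thesis
    proof (rule exI[of _ "\<lambda>q. n + q"], rule exI[of _ "\<lambda>q. n + 2 * q"], intro conjI ballI)
      fix q
      obtain k where k: "norm k \<le> 2" "g n = k * g (n + q) - g (n + 2 * q)" using step by blast
      show "(norm (g n))\<^sup>2 \<le> 8 * (norm (g (n + q)))\<^sup>2 + 2 * (norm (g (n + 2 * q)))\<^sup>2"
        by (subst k(2)) (rule sq[OF k(1)])
    qed (use True n in \<open>auto simp: inj_on_def\<close>)
  next
    case False
    hence n2: "2 * m < n" using m by linarith
    show ?thesis
    proof (rule exI[of _ "\<lambda>q. n - q"], rule exI[of _ "\<lambda>q. n - 2 * q"], intro conjI ballI)
      fix q assume q: "q \<in> {1..m}"
      obtain k where k: "norm k \<le> 2" "g (n - 2 * q + 2 * q) = k * g (n - 2 * q + q) - g (n - 2 * q)"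
        using step by blast
      have e: "n - 2 * q + 2 * q = n" "n - 2 * q + q = n - q" using q n2 by auto
      show "(norm (g n))\<^sup>2 \<le> 8 * (norm (g (n - q)))\<^sup>2 + 2 * (norm (g (n - 2 * q)))\<^sup>2"
        using sq[OF k(1)] k(2) unfolding e by simp
    qed (use n2 n in \<open>auto simp: inj_on_def\<close>)
  qed
  then obtain f h where "inj_on f {1..m} \<and> f ` {1..m} \<subseteq> {1..N} \<and> inj_on h {1..m} \<and> h ` {1..m} \<subseteq> {1..N}
      \<and> (\<forall>q\<in>{1..m}. (norm (g n))\<^sup>2 \<le> 8 * (norm (g (f q)))\<^sup>2 + 2 * (norm (g (h q)))\<^sup>2)"
    by (elim exE)
  note fh = this[THEN conjunct1] this[THEN conjunct2, THEN conjunct1]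
    this[THEN conjunct2, THEN conjunct2, THEN conjunct1]
    this[THEN conjunct2, THEN conjunct2, THEN conjunct2, THEN conjunct1]
    this[THEN conjunct2, THEN conjunct2, THEN conjunct2, THEN conjunct2]
  have "real m * (norm (g n))\<^sup>2 = (\<Sum>q\<in>{1..m}. (norm (g n))\<^sup>2)" by simp
  also have "\<dots> \<le> (\<Sum>q\<in>{1..m}. 8 * (norm (g (f q)))\<^sup>2 + 2 * (norm (g (h q)))\<^sup>2)"
    by (intro sum_mono bspec[OF fh(5)])
  also have "\<dots> = 8 * (\<Sum>q\<in>{1..m}. (norm (g (f q)))\<^sup>2) + 2 * (\<Sum>q\<in>{1..m}. (norm (g (h q)))\<^sup>2)"
    by (simp add: sum.distrib sum_distrib_left)
  also have "\<dots> \<le> 8 * S + 2 * S"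
    using sub[OF fh(1,2)] sub[OF fh(3,4)] by (intro add_mono mult_left_mono) auto
  finally have 1: "real m * (norm (g n))\<^sup>2 \<le> 10 * S" by simp
  have "S \<le> G\<^sup>2"
  proof -
    have "0 \<le> S" by (simp add: S_def sum_nonneg)
    hence "S = (L2_set (\<lambda>n. norm (g n)) {1..N})\<^sup>2" by (simp add: L2_set_def S_def)
    thus ?thesis using L2 by (simp add: power_mono)
  qed
  have "real N * (norm (g n))\<^sup>2 \<le> (8 * real m) * (norm (g n))\<^sup>2"
    using m(3) by (intro mult_right_mono) auto
  also have "\<dots> \<le> 80 * G\<^sup>2" using 1 \<open>S \<le> G\<^sup>2\<close> by simp
  also have "\<dots> \<le> 81 * G\<^sup>2" by simp
  finally have "(norm (g n))\<^sup>2 \<le> (9 * G / sqrt (real N))\<^sup>2"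
    using N by (simp add: power_divide power_mult_distrib pos_le_divide_eq mult.commute)
  moreover have "0 \<le> G" by (rule order_trans[OF L2_set_nonneg L2])
  hence "0 \<le> 9 * G / sqrt (real N)" by simp
  ultimately show ?thesis by (rule power2_le_imp_le)
qed

definition evanescent_const :: "nat \<Rightarrow> real" where
  "evanescent_const r = 2 * real r * 7 ^ r * root_const r"

lemma evanescent_const_nonneg: "0 \<le> evanescent_const r"
  by (simp add: evanescent_const_def root_const_def state_const_nonneg)

lemma coeff_linear_power_top:
  fixes p :: "complex poly"
  assumes "degree p \<le> d"
  shows "coeff ([:1, -1:] ^ r * p) (r + d) = (-1) ^ r * coeff p d"
proof (cases "degree p = d")
  case True
  have "coeff ([:1, -1:] ^ r * p) (degree ([:1, -1::complex:] ^ r) + degree p) = lead_coeff ([:1, -1:] ^ r) * lead_coeff p"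
    by (rule coeff_mult_degree_sum)
  thus ?thesis using True by (simp add: degree_power_eq lead_coeff_power)
next
  case False
  hence d: "degree p < d" using assms by simp
  have "degree ([:1, -1:] ^ r * p) \<le> r + degree p"
    using degree_mult_le[of "[:1, -1:] ^ r" p] by (simp add: degree_power_eq)
  hence "coeff ([:1, -1:] ^ r * p) (r + d) = 0" using d by (intro coeff_eq_0) auto
  thus ?thesis using d by (simp add: coeff_eq_0)
qed

context singular_pair
begin

text \<open>\<open>z\<^sup>r\<^sup>-\<^sup>1\<close> times the state. The sum is the tail overflow with its \<open>r\<close> coefficients in reverse order, that
is, \<open>z\<^sup>r\<^sup>-\<^sup>1\<close> times its value at \<open>1/z\<close>.\<close>

definition state_poly :: "nat \<Rightarrow> complex poly" where
  "state_poly n = [:1, -1:] ^ r * (\<Sum>k<r. monom (coeff (tail_overflow n) k) (r - Suc k))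
     - monom (of_real (c ^ r)) r * overflow r c v u n"

lemma degree_tail_overflow: "degree (tail_overflow n) < r"
  unfolding tail_overflow_def by (rule degree_overflow[OF r_pos])

lemma poly_state_poly:
  assumes "z \<noteq> 0"
  shows "poly (state_poly n) z = z ^ (r - 1) * state n z"
proof -
  have "poly (tail_overflow n) (1 / z) = (\<Sum>k\<le>r-1. coeff (tail_overflow n) k * (1 / z) ^ k)"
  proof -
    have "degree (tail_overflow n) \<le> r - 1" using degree_tail_overflow[of n] by simp
    from poly_as_sum_of_monoms'[OF this]
    have "poly (tail_overflow n) (1 / z) = poly (\<Sum>k\<le>r-1. monom (coeff (tail_overflow n) k) k) (1 / z)" by simp
    thus ?thesis by (simp add: poly_sum poly_monom)
  qed
  also have "{..r-1} = {..<r}" using r_pos by auto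
  finally have "z ^ (r - 1) * poly (tail_overflow n) (1 / z)
      = (\<Sum>k<r. z ^ (r - 1) * (coeff (tail_overflow n) k * (1 / z) ^ k))" by (simp add: sum_distrib_left)
  also have "\<dots> = (\<Sum>k<r. coeff (tail_overflow n) k * z ^ (r - Suc k))"
  proof (rule sum.cong)
    fix k assume "k \<in> {..<r}"
    hence "z ^ (r - 1) = z ^ (r - Suc k) * z ^ k" by (simp flip: power_add)
    thus "z ^ (r - 1) * (coeff (tail_overflow n) k * (1 / z) ^ k) = coeff (tail_overflow n) k * z ^ (r - Suc k)"
      using assms by (simp add: power_one_over)
  qed simp
  finally have "(\<Sum>k<r. coeff (tail_overflow n) k * z ^ (r - Suc k)) = z ^ (r - 1) * poly (tail_overflow n) (1 / z)" ..
  moreover have "z ^ r = z ^ (r - 1) * z" using r_pos by (simp add: power_eq_if)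
  ultimately show ?thesis
    by (simp add: state_poly_def state_def poly_sum poly_monom poly_power algebra_simps)
qed

lemma degree_state_poly: "degree (state_poly n) < 2 * r"
proof -
  have 1: "degree (\<Sum>k<r. monom (coeff (tail_overflow n) k) (r - Suc k)) \<le> r - 1"
    by (intro degree_sum_le) (auto intro: order_trans[OF degree_monom_le])
  have "degree ([:1, -1:] ^ r * (\<Sum>k<r. monom (coeff (tail_overflow n) k) (r - Suc k))) \<le> r + (r - 1)"
    using degree_mult_le[of "[:1, -1:] ^ r" "\<Sum>k<r. monom (coeff (tail_overflow n) k) (r - Suc k)"] 1
    by (simp add: degree_power_eq)
  moreover have "degree (monom (of_real (c ^ r)) r * overflow r c v u n) \<le> r + (r - 1)"
    using degree_mult_le[of "monom (of_real (c ^ r)) r" "overflow r c v u n"]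
      degree_monom_le[of "complex_of_real (c ^ r)" r] degree_overflow[OF r_pos, of c v u n] by linarith
  ultimately have "degree (state_poly n) \<le> r + (r - 1)"
    unfolding state_poly_def by (rule degree_diff_le)
  thus ?thesis using r_pos by linarith
qed

text \<open>The entry \<open>u\<^sub>n\<close> can be read off from the state just after position \<open>n\<close>. The lowest coefficient of the
tail overflow is \<open>c\<^sup>r v\<^sub>n - u\<^sub>n\<close>, since the complete difference of order \<open>r\<close> there would be \<open>c\<^sup>r v\<^sub>n\<close>
and only the term \<open>u\<^sub>n\<close> has been cut off. The highest coefficient of the other overflow is
\<open>v\<^sub>n\<close> up to sign, and the multiples of \<open>v\<^sub>n\<close> cancel.\<close>

lemma state_poly_top_coeff:
  assumes "n < N"
  shows "coeff (state_poly (Suc n)) (2 * r - 1) = - ((-1) ^ r) * of_real (u n)"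
proof -
  interpret rev: singular_pair N r c "reversed N u" "reversed N v"
    by (rule singular_pair_reversed) (rule singular_pair_axioms)
  define m where "m = N - Suc n"
  have m: "m < N" "N - Suc m = n" using assms by (auto simp: m_def)
  let ?S = "\<Sum>k<r. monom (coeff (tail_overflow (Suc n)) k) (r - Suc k)"
  have idx: "2 * r - 1 = r + (r - 1)" using r_pos by simp
  have dS: "degree ?S \<le> r - 1"
    by (intro degree_sum_le) (auto intro: order_trans[OF degree_monom_le])
  have cS: "coeff ?S (r - 1) = coeff (tail_overflow (Suc n)) 0"
  proof -
    have "coeff ?S (r - 1) = (\<Sum>k<r. if k = 0 then coeff (tail_overflow (Suc n)) 0 else 0)"
      unfolding coeff_sum by (rule sum.cong) auto
    thus ?thesis using r_pos by simp
  qed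
  have "coeff (tail_overflow (Suc n)) 0 = coeff ([:1, -1:] ^ r * gen_poly (reversed N u) m) m"
    by (simp add: tail_overflow_def overflow_def coeff_poly_shift m_def[symmetric] coeff_gen_poly)
  also have "\<dots> = coeff ([:1, -1:] ^ r * gen_poly (reversed N u) (Suc m)) m - of_real (reversed N u m)"
  proof -
    have "coeff ([:1, -1::complex:] ^ r) 0 = 1" by (simp add: coeff_0_power)
    hence "coeff ([:1, -1:] ^ r * monom (complex_of_real (reversed N u m)) m) m = of_real (reversed N u m)"
      by (simp add: mult.commute[of _ "monom _ _"] coeff_monom_mult)
    thus ?thesis by (simp add: gen_poly_Suc distrib_left)
  qed
  also have "coeff ([:1, -1:] ^ r * gen_poly (reversed N u) (Suc m)) m = of_real (c ^ r * reversed N v m)"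
    by (rule rev.forward_truncated) (use m in auto)
  also have "of_real (c ^ r * reversed N v m) - of_real (reversed N u m) = complex_of_real (c ^ r * v n - u n)"
    using m by (simp add: reversed_def)
  finally have t0: "coeff (tail_overflow (Suc n)) 0 = of_real (c ^ r * v n - u n)" .
  have p: "coeff (overflow r c v u (Suc n)) (r - 1) = (-1) ^ r * of_real (v n)"
  proof -
    have "coeff ([:1, -1:] ^ r * gen_poly v (Suc n)) (r + n) = (-1) ^ r * coeff (gen_poly v (Suc n)) n"
      by (rule coeff_linear_power_top) (use degree_gen_poly[of v "Suc n"] in simp)
    moreover have "r - 1 + Suc n = r + n" using r_pos by simp
    ultimately show ?thesis
      using r_pos by (simp add: overflow_def coeff_poly_shift coeff_gen_poly)
  qed
  have "coeff (state_poly (Suc n)) (2 * r - 1)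
    = (-1) ^ r * of_real (c ^ r * v n - u n) - of_real (c ^ r) * ((-1) ^ r * of_real (v n))"
    unfolding state_poly_def idx coeff_diff coeff_linear_power_top[OF dS] cS t0 p[symmetric]
    by (simp add: coeff_monom_mult)
  also have "\<dots> = - ((-1) ^ r) * of_real (u n)"
    by (simp add: algebra_simps)
  finally show ?thesis .
qed

text \<open>The decomposition of \<open>u\<close> into modes, obtained by interpolation of \<open>state_poly\<close> at all \<open>2 r\<close> roots.\<close>

lemma modal_expansion:
  assumes "n < N"
  shows "of_real (u n) = (\<Sum>z\<in>char_roots r c.
    - ((-1) ^ r) * (z ^ (r - 1) * state (Suc n) z / poly (pderiv (char_root_poly r c)) z))"
proof -
  note Z = char_roots_simple[OF r_pos c_pos c_less]
  have sq: "(-1) ^ r * (-1) ^ r = (1::complex)" by (simp flip: power_add)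
  have "coeff (state_poly (Suc n)) (card (char_roots r c) - 1)
    = (\<Sum>z\<in>char_roots r c. poly (state_poly (Suc n)) z / (\<Prod>w\<in>char_roots r c - {z}. z - w))"
    by (rule top_coeff_by_interpolation[OF Z(1)]) (use degree_state_poly Z(2) in simp)
  also have "\<dots> = (\<Sum>z\<in>char_roots r c. z ^ (r - 1) * state (Suc n) z / poly (pderiv (char_root_poly r c)) z)"
  proof (rule sum.cong)
    fix z assume z: "z \<in> char_roots r c"
    hence z0: "z \<noteq> 0" by (simp add: char_roots_def)
    show "poly (state_poly (Suc n)) z / (\<Prod>w\<in>char_roots r c - {z}. z - w)
        = z ^ (r - 1) * state (Suc n) z / poly (pderiv (char_root_poly r c)) z"
      by (simp only: Z(3)[OF z] poly_state_poly[OF z0])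
  qed simp
  finally have "- ((-1) ^ r) * of_real (u n)
      = (\<Sum>z\<in>char_roots r c. z ^ (r - 1) * state (Suc n) z / poly (pderiv (char_root_poly r c)) z)"
    unfolding Z(2) state_poly_top_coeff[OF assms] .
  hence "- ((-1) ^ r) * (- ((-1) ^ r) * of_real (u n)) = - ((-1) ^ r) *
      (\<Sum>z\<in>char_roots r c. z ^ (r - 1) * state (Suc n) z / poly (pderiv (char_root_poly r c)) z)"
    by (rule arg_cong)
  moreover have "- ((-1) ^ r) * (- ((-1) ^ r) * of_real (u n)) = complex_of_real (u n)"
    using sq by (simp add: mult.assoc[symmetric])
  ultimately show ?thesis by (simp only: sum_distrib_left)
qed

definition evanescent_roots :: "complex set" where
  "evanescent_roots = {z \<in> char_roots r c. 2 - z - 1 / z \<noteq> of_real (c\<^sup>2)}"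

text \<open>The term of the root \<open>z\<close> in the modal expansion of \<open>u\<^sub>n\<^sub>-\<^sub>1\<close>: the state after \<open>n\<close> entries belongs to the
entry with index \<open>n - 1\<close>.\<close>

definition mode :: "nat \<Rightarrow> complex \<Rightarrow> complex" where
  "mode n z = - ((-1) ^ r) * (z ^ (r - 1) * state n z / poly (pderiv (char_root_poly r c)) z)"

text \<open>The powers of \<open>c\<close> and of \<open>\<bar>z\<bar>\<close> in the state bound and in the lower bound for the derivative are the
same, so the estimate is uniform in \<open>c\<close>, that is, in the singular value.\<close>

lemma evanescent_part_bound:
  assumes n: "n \<le> N"
  shows "norm (\<Sum>z\<in>evanescent_roots. mode n z) \<le> evanescent_const r / sqrt (real N)"
proof -
  note Z = char_roots_simple[OF r_pos c_pos c_less]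
  let ?B = "7 ^ r * root_const r / sqrt (real N)"
  have sub: "evanescent_roots \<subseteq> char_roots r c" by (auto simp: evanescent_roots_def)
  have B0: "0 \<le> ?B" by (simp add: root_const_def state_const_nonneg)
  have "norm (mode n z) \<le> ?B" if z: "z \<in> evanescent_roots" for z
  proof -
    have zr: "z \<in> char_roots r c" and ne: "2 - z - 1 / z \<noteq> of_real (c\<^sup>2)"
      using z by (auto simp: evanescent_roots_def)
    have z0: "z \<noteq> 0" using zr by (simp add: char_roots_def)
    let ?D = "norm (poly (pderiv (char_root_poly r c)) z)"
    have D: "c ^ (2 * r - 1) * norm z ^ (r - 1) \<le> ?D"
      by (rule norm_pderiv_char_root_poly_ge[OF zr r_ge c_pos c_less ne])
    have D0: "0 < c ^ (2 * r - 1) * norm z ^ (r - 1)" using c_pos z0 by simp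
    have c2: "c ^ r * c ^ (r - 1) = c ^ (2 * r - 1)"
    proof -
      have "2 * r - 1 = r + (r - 1)" using r_pos by simp
      thus ?thesis by (simp only: power_add)
    qed
    have "norm (mode n z) = norm z ^ (r - 1) * norm (state n z) / ?D"
      by (simp add: mode_def norm_mult norm_divide norm_power)
    also have "\<dots> \<le> norm z ^ (r - 1) * (7 ^ r * c ^ r * (root_const r * c ^ (r - 1) / sqrt (real N))) / ?D"
      using D D0 by (intro divide_right_mono mult_left_mono state_bound[OF zr n]) auto
    also have "norm z ^ (r - 1) * (7 ^ r * c ^ r * (root_const r * c ^ (r - 1) / sqrt (real N)))
        = ?B * (c ^ (2 * r - 1) * norm z ^ (r - 1))"
      unfolding c2[symmetric] by (simp add: mult_ac)
    also have "\<dots> / ?D \<le> ?B"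
      using D D0 B0 by (simp only: pos_divide_le_eq) (intro mult_left_mono)
    finally show ?thesis .
  qed
  hence "norm (\<Sum>z\<in>evanescent_roots. mode n z) \<le> (\<Sum>z\<in>evanescent_roots. ?B)"
    by (rule sum_norm_le)
  also have "\<dots> = real (card evanescent_roots) * ?B" by simp
  also have "\<dots> \<le> real (2 * r) * ?B"
    using card_mono[OF Z(1) sub] Z(2) B0 by (intro mult_right_mono) auto
  finally show ?thesis by (simp add: evanescent_const_def mult_ac)
qed

lemma mode_propagates:
  assumes "z \<in> char_roots r c" "n \<le> N"
  shows "mode n z = mode 0 z * (1 / z) ^ n"
proof -
  have "z \<noteq> 0" using assms(1) by (simp add: char_roots_def)
  moreover have "z ^ n * state n z = state 0 z"
    using state_conserved[OF assms] state_0 by simp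
  ultimately have "state n z = state 0 z * (1 / z) ^ n" by (simp add: power_one_over field_simps)
  thus ?thesis by (simp add: mode_def)
qed

text \<open>Both \<open>u\<close> and its evanescent part have bounded \<open>\<ell>\<^sup>2\<close> norm, hence so has the oscillating part, to which
\<open>oscillation_bound\<close> applies.\<close>

lemma singular_vector_bound:
  assumes N: "4 \<le> N" and n: "n < N"
  shows "\<bar>u n\<bar> \<le> (9 + 10 * evanescent_const r) / sqrt (real N)"
proof -
  note Z = char_roots_simple[OF r_pos c_pos c_less]
  let ?H = "evanescent_const r"
  \<comment> \<open>the oscillating roots; \<open>g\<close> and \<open>h\<close> are the oscillating and the evanescent part of \<open>u\<close>, shifted by one\<close>
  define Z0 where "Z0 = char_roots r c - evanescent_roots"
  define h where "h n = (\<Sum>z\<in>evanescent_roots. mode n z)" for n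
  define g where "g n = (\<Sum>z\<in>Z0. mode 0 z * (1 / z) ^ n)" for n
  have Z0: "z \<in> char_roots r c" "2 - z - 1 / z = of_real (c\<^sup>2)" "norm z = 1" if "z \<in> Z0" for z
  proof -
    show z: "z \<in> char_roots r c" "2 - z - 1 / z = of_real (c\<^sup>2)"
      using that by (auto simp: Z0_def evanescent_roots_def)
    have "z \<noteq> 0" using z(1) by (simp add: char_roots_def)
    thus "norm z = 1" using z(2) c_pos c_less by (rule oscillating_root_unit)
  qed
  have split: "complex_of_real (u i) = g (Suc i) + h (Suc i)" if "i < N" for i
  proof -
    have "evanescent_roots \<subseteq> char_roots r c" by (auto simp: evanescent_roots_def)
    hence "(\<Sum>z\<in>char_roots r c. mode (Suc i) z) = (\<Sum>z\<in>Z0. mode (Suc i) z) + h (Suc i)"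
      unfolding Z0_def h_def using Z(1) by (rule sum.subset_diff)
    moreover have "(\<Sum>z\<in>Z0. mode (Suc i) z) = g (Suc i)"
      unfolding g_def
      by (intro sum.cong refl mode_propagates Z0(1)) (use that in auto)
    ultimately show ?thesis using modal_expansion[OF that] by (simp only: mode_def)
  qed
  have hb: "norm (h (Suc i)) \<le> ?H / sqrt (real N)" if "i < N" for i
    unfolding h_def by (rule evanescent_part_bound) (use that in simp)
  have "L2_set (\<lambda>n. norm (g n)) {1..N} = L2_set (\<lambda>i. norm (g (Suc i))) {..<N}"
    unfolding L2_set_def
    by (rule arg_cong[of _ _ sqrt], rule sum.reindex_bij_witness[of _ Suc "\<lambda>i. i - 1"]) auto
  also have "\<dots> \<le> L2_set (\<lambda>i. \<bar>u i\<bar> + ?H / sqrt (real N)) {..<N}"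
  proof (rule L2_set_mono)
    fix i assume "i \<in> {..<N}"
    hence i: "i < N" by simp
    have "g (Suc i) = of_real (u i) - h (Suc i)" using split[OF i] by simp
    hence "norm (g (Suc i)) \<le> \<bar>u i\<bar> + norm (h (Suc i))"
      using norm_triangle_ineq4[of "complex_of_real (u i)" "h (Suc i)"] by simp
    thus "norm (g (Suc i)) \<le> \<bar>u i\<bar> + ?H / sqrt (real N)" using hb[OF i] by linarith
  qed simp
  also have "\<dots> \<le> L2_set (\<lambda>i. \<bar>u i\<bar>) {..<N} + L2_set (\<lambda>i. ?H / sqrt (real N)) {..<N}"
    by (rule L2_set_triangle_ineq)
  also have "L2_set (\<lambda>i. \<bar>u i\<bar>) {..<N} = 1" by (simp add: L2_set_def norm_u)
  also have "L2_set (\<lambda>i. ?H / sqrt (real N)) {..<N} = ?H"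
    using N evanescent_const_nonneg[of r] by (simp add: L2_set_constant)
  finally have L2: "L2_set (\<lambda>n. norm (g n)) {1..N} \<le> 1 + ?H" .
  have "norm (g (Suc n)) \<le> 9 * (1 + ?H) / sqrt (real N)"
  proof (rule oscillation_bound[of Z0 g "mode 0" N "1 + ?H" "Suc n"])
    show "finite Z0" using Z(1) by (simp add: Z0_def)
    show "norm z = 1" if "z \<in> Z0" for z by (rule Z0(3)[OF that])
    show "2 - z - 1 / z = 2 - w - 1 / w" if "z \<in> Z0" "w \<in> Z0" for z w
      unfolding Z0(2)[OF that(1)] Z0(2)[OF that(2)] ..
  qed (use L2 N n in \<open>simp_all add: g_def\<close>)
  moreover have "\<bar>u n\<bar> \<le> norm (g (Suc n)) + norm (h (Suc n))"
    using norm_triangle_ineq[of "g (Suc n)" "h (Suc n)"] unfolding split[OF n, symmetric] by simp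
  ultimately have "\<bar>u n\<bar> \<le> 9 * (1 + ?H) / sqrt (real N) + ?H / sqrt (real N)"
    using hb[OF n] by linarith
  also have "\<dots> = (9 + 10 * ?H) / sqrt (real N)" by (simp add: add_divide_distrib[symmetric] algebra_simps)
  finally show ?thesis .
qed

end

section \<open>Singular vectors of powers of the difference matrix\<close>

lemma coeff_linear_mult:
  "coeff ([:1, -1:] * W) i = coeff W i - (if i = 0 then 0 else coeff W (i - 1))" for W :: "'a::comm_ring_1 poly"
  by (cases i) (simp_all add: mult_pCons_left)

lemma diff_mat_carrier [simp]: "diff_mat N \<in> carrier_mat N N"
  by (simp add: diff_mat_def)

lemma diff_mat_power_carrier [simp]: "diff_mat N ^\<^sub>m k \<in> carrier_mat N N"
  by (rule pow_carrier_mat) simp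

lemma diff_mat_mult_vec:
  assumes "x \<in> carrier_vec N" "i < N"
  shows "(diff_mat N *\<^sub>v x) $ i = x $ i - (if i = 0 then 0 else x $ (i - 1))"
proof -
  have "(diff_mat N *\<^sub>v x) $ i = (\<Sum>j\<in>{0..<N}. (if j = i then x $ j else 0) - (if i = j + 1 then x $ j else 0))"
    using assms by (auto simp: diff_mat_def scalar_prod_def intro!: sum.cong)
  also have "\<dots> = x $ i - (\<Sum>j\<in>{0..<N}. if i = j + 1 then x $ j else 0)"
    using assms by (simp add: sum_subtractf)
  also have "(\<Sum>j\<in>{0..<N}. if i = j + 1 then x $ j else 0) = (if i = 0 then 0 else x $ (i - 1))"
  proof (cases i)
    case (Suc k)
    hence "(\<Sum>j\<in>{0..<N}. if i = j + 1 then x $ j else 0) = (\<Sum>j\<in>{0..<N}. if j = k then x $ j else 0)"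
      by (intro sum.cong) auto
    thus ?thesis using Suc assms by simp
  qed simp
  finally show ?thesis .
qed

lemma diff_mat_transpose_mult_vec:
  assumes "x \<in> carrier_vec N" "i < N"
  shows "(transpose_mat (diff_mat N) *\<^sub>v x) $ i = x $ i - (if Suc i < N then x $ Suc i else 0)"
proof -
  have "(transpose_mat (diff_mat N) *\<^sub>v x) $ i
      = (\<Sum>j\<in>{0..<N}. (if j = i then x $ j else 0) - (if j = Suc i then x $ j else 0))"
    using assms by (auto simp: diff_mat_def scalar_prod_def intro!: sum.cong)
  also have "\<dots> = x $ i - (if Suc i < N then x $ Suc i else 0)"
    using assms by (simp add: sum_subtractf)
  finally show ?thesis .
qed

lemma coeff_diff_mat_power:
  assumes "x \<in> carrier_vec N" "\<And>i. i < N \<Longrightarrow> coeff W i = complex_of_real (x $ i)" "i < N"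
  shows "coeff ([:1, -1:] ^ k * W) i = of_real ((diff_mat N ^\<^sub>m k *\<^sub>v x) $ i)"
  using assms
proof (induction k arbitrary: W x i)
  case 0
  thus ?case by (simp add: diff_mat_def)
next
  case (Suc k)
  have "[:1, -1:] ^ Suc k * W = [:1, -1:] ^ k * ([:1, -1:] * W)"
    by (simp only: power_Suc2 mult.assoc)
  moreover have "coeff ([:1, -1:] ^ k * ([:1, -1:] * W)) i
      = of_real ((diff_mat N ^\<^sub>m k *\<^sub>v (diff_mat N *\<^sub>v x)) $ i)"
  proof (rule Suc.IH)
    show "diff_mat N *\<^sub>v x \<in> carrier_vec N" using Suc.prems(1) by (intro mult_mat_vec_carrier[of _ N N]) auto
    show "coeff ([:1, -1:] * W) l = of_real ((diff_mat N *\<^sub>v x) $ l)" if "l < N" for l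
      using Suc.prems(1,2) that by (simp only: coeff_linear_mult diff_mat_mult_vec) simp
  qed (rule Suc.prems(3))
  moreover have "diff_mat N ^\<^sub>m k *\<^sub>v (diff_mat N *\<^sub>v x) = diff_mat N ^\<^sub>m Suc k *\<^sub>v x"
    using Suc.prems(1) by (simp add: assoc_mult_mat_vec[of _ N N _ N])
  ultimately show ?case by simp
qed

lemma coeff_diff_mat_power_transpose:
  assumes "x \<in> carrier_vec N" "\<And>i. i < N \<Longrightarrow> coeff W i = complex_of_real (x $ (N - Suc i))" "i < N"
  shows "coeff ([:1, -1:] ^ k * W) i = of_real ((transpose_mat (diff_mat N ^\<^sub>m k) *\<^sub>v x) $ (N - Suc i))"
  using assms(3)
proof (induction k arbitrary: i)
  case 0
  thus ?case using assms by (simp add: diff_mat_def)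
next
  case (Suc k)
  let ?y = "transpose_mat (diff_mat N ^\<^sub>m k) *\<^sub>v x"
  have y: "?y \<in> carrier_vec N"
    using assms(1) by (intro mult_mat_vec_carrier[of _ N N]) auto
  have "[:1, -1:] ^ Suc k * W = [:1, -1:] * ([:1, -1:] ^ k * W)"
    by (simp only: power_Suc mult.assoc)
  hence "coeff ([:1, -1:] ^ Suc k * W) i
      = coeff ([:1, -1:] ^ k * W) i - (if i = 0 then 0 else coeff ([:1, -1:] ^ k * W) (i - 1))"
    by (simp only: coeff_linear_mult)
  also have "\<dots> = of_real (?y $ (N - Suc i) - (if Suc (N - Suc i) < N then ?y $ Suc (N - Suc i) else 0))"
  proof (cases i)
    case 0
    thus ?thesis using Suc by simp
  next
    case (Suc l)
    hence "Suc (N - Suc i) = N - Suc l" "Suc (N - Suc i) < N" using Suc.prems by auto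
    thus ?thesis using Suc.IH[of i] Suc.IH[of l] Suc Suc.prems by simp
  qed
  also have "\<dots> = of_real ((transpose_mat (diff_mat N) *\<^sub>v ?y) $ (N - Suc i))"
    using Suc.prems by (subst diff_mat_transpose_mult_vec[OF y]) auto
  also have "transpose_mat (diff_mat N) *\<^sub>v ?y = transpose_mat (diff_mat N ^\<^sub>m Suc k) *\<^sub>v x"
  proof -
    have "transpose_mat (diff_mat N ^\<^sub>m Suc k) = transpose_mat (diff_mat N) * transpose_mat (diff_mat N ^\<^sub>m k)"
      by (simp add: transpose_mult[of _ N N _ N])
    thus ?thesis using assms(1) by (simp add: assoc_mult_mat_vec[of _ N N _ N])
  qed
  finally show ?case .
qed

lemma linear_power_coeffs_zero:
  fixes W :: "complex poly"
  assumes "\<And>i. i < N \<Longrightarrow> coeff ([:1, -1:] ^ k * W) i = 0" "i < N"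
  shows "coeff W i = 0"
  using assms
proof (induction k arbitrary: i)
  case (Suc k)
  have e: "[:1, -1:] ^ Suc k * W = [:1, -1:] * ([:1, -1:] ^ k * W)"
    by (simp only: power_Suc mult.assoc)
  have "coeff ([:1, -1:] ^ k * W) l = 0" if "l < N" for l
    using that
  proof (induction l)
    case 0
    thus ?case using Suc.prems(1)[of 0] unfolding e coeff_linear_mult by simp
  next
    case (Suc m)
    thus ?case using Suc.prems \<open>\<And>i. i < N \<Longrightarrow> coeff ([:1, -1:] ^ Suc k * W) i = 0\<close>[of "Suc m"]
      unfolding e coeff_linear_mult by simp
  qed
  thus ?case using Suc by blast
qed simp

definition energy :: "nat \<Rightarrow> complex poly \<Rightarrow> real" where
  "energy N W = (\<Sum>i<N. (norm (coeff W i))\<^sup>2)"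

text \<open>The parallelogram identity for \<open>W\<^sub>i - W\<^sub>i\<^sub>-\<^sub>1\<close> and \<open>W\<^sub>i + W\<^sub>i\<^sub>-\<^sub>1\<close>. Equality would force
\<open>W\<^sub>0 = 0\<close> and \<open>W\<^sub>i = -W\<^sub>i\<^sub>-\<^sub>1\<close> for all other \<open>i\<close>, hence energy zero. The strict inequality gives \<open>c < 2\<close>, on
which the simplicity of the roots depends.\<close>

lemma energy_linear_mult:
  shows "energy N ([:1, -1:] * W) \<le> 4 * energy N W"
    and "0 < energy N W \<Longrightarrow> energy N ([:1, -1:] * W) < 4 * energy N W"
proof -
  define b where "b i = (if i = 0 then 0 else coeff W (i - 1))" for i
  define s where "s = (\<Sum>i<N. (norm (coeff W i + b i))\<^sup>2)"
  have s0: "0 \<le> s" by (simp add: s_def sum_nonneg)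
  have b: "(\<Sum>i<N. (norm (b i))\<^sup>2) \<le> energy N W"
  proof (cases N)
    case (Suc M)
    have "(\<Sum>i<N. (norm (b i))\<^sup>2) = (\<Sum>i<M. (norm (coeff W i))\<^sup>2)"
      unfolding Suc sum.lessThan_Suc_shift by (simp add: b_def)
    also have "\<dots> \<le> energy N W" by (simp add: energy_def Suc)
    finally show ?thesis .
  qed (simp add: energy_def)
  have "energy N ([:1, -1:] * W) + s = (\<Sum>i<N. 2 * (norm (coeff W i))\<^sup>2 + 2 * (norm (b i))\<^sup>2)"
    unfolding energy_def s_def coeff_linear_mult b_def[symmetric] sum.distrib[symmetric]
  proof (rule sum.cong)
    fix i
    have "(norm (x - y))\<^sup>2 + (norm (x + y))\<^sup>2 = 2 * (norm x)\<^sup>2 + 2 * (norm y)\<^sup>2" for x y :: complex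
      by (simp add: cmod_power2 power2_sum power2_diff)
    thus "(norm (coeff W i - b i))\<^sup>2 + (norm (coeff W i + b i))\<^sup>2 = 2 * (norm (coeff W i))\<^sup>2 + 2 * (norm (b i))\<^sup>2" .
  qed simp
  also have "\<dots> = 2 * energy N W + 2 * (\<Sum>i<N. (norm (b i))\<^sup>2)"
    by (simp add: energy_def sum.distrib sum_distrib_left)
  finally have sum: "energy N ([:1, -1:] * W) + s \<le> 4 * energy N W" using b by linarith
  thus "energy N ([:1, -1:] * W) \<le> 4 * energy N W" using s0 by linarith
  assume pos: "0 < energy N W"
  have "s \<noteq> 0"
  proof
    assume "s = 0"
    hence z: "coeff W i + b i = 0" if "i < N" for i
      using that unfolding s_def by (subst (asm) sum_nonneg_eq_0_iff) auto
    have "coeff W i = 0" if "i < N" for i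
      using that
    proof (induction i)
      case 0
      thus ?case using z[of 0] by (simp add: b_def)
    next
      case (Suc i)
      thus ?case using z[of "Suc i"] by (simp add: b_def)
    qed
    thus False using pos by (simp add: energy_def)
  qed
  thus "energy N ([:1, -1:] * W) < 4 * energy N W" using sum s0 by linarith
qed

lemma energy_linear_power_less:
  assumes "0 < k" "0 < energy N W"
  shows "energy N ([:1, -1:] ^ k * W) < 4 ^ k * energy N W"
proof -
  have le: "energy N ([:1, -1:] ^ l * W') \<le> 4 ^ l * energy N W'" for l W'
  proof (induction l)
    case (Suc l)
    have "energy N ([:1, -1:] ^ Suc l * W') \<le> 4 * energy N ([:1, -1:] ^ l * W')"
      unfolding power_Suc mult.assoc by (rule energy_linear_mult(1))
    thus ?case using Suc by simp
  qed simp
  obtain l where l: "k = Suc l" using assms(1) gr0_implies_Suc by blast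
  have "energy N ([:1, -1:] ^ k * W) \<le> 4 ^ l * energy N ([:1, -1:] * W)"
    unfolding l power_Suc2 mult.assoc by (rule le)
  also have "\<dots> < 4 ^ l * (4 * energy N W)"
    using energy_linear_mult(2)[OF assms(2)] by simp
  finally show ?thesis by (simp add: l)
qed

lemma svd_vectors:
  assumes svd: "is_svd N A U S V" and j: "j < N"
  shows "A *\<^sub>v col V j = S $$ (j, j) \<cdot>\<^sub>v col U j"
    and "transpose_mat A *\<^sub>v col U j = S $$ (j, j) \<cdot>\<^sub>v col V j"
    and "(\<Sum>i<N. (col U j $ i)\<^sup>2) = 1" "(\<Sum>i<N. (col V j $ i)\<^sup>2) = 1"
proof -
  have car: "A \<in> carrier_mat N N" "U \<in> carrier_mat N N" "S \<in> carrier_mat N N" "V \<in> carrier_mat N N"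
    and UU: "transpose_mat U * U = 1\<^sub>m N" and VV: "transpose_mat V * V = 1\<^sub>m N"
    and S: "diagonal_mat S" and A: "A = U * S * transpose_mat V"
    using svd by (auto simp: is_svd_def)
  have scaled: "X *\<^sub>v col T j = S $$ (j, j) \<cdot>\<^sub>v col X j"
    if "X \<in> carrier_mat N N" "T \<in> carrier_mat N N" "T = S \<or> T = transpose_mat S" for X T
  proof (rule eq_vecI)
    fix i assume "i < dim_vec (S $$ (j, j) \<cdot>\<^sub>v col X j)"
    hence i: "i < N" using that by simp
    have T: "T $$ (k, j) = (if k = j then S $$ (j, j) else 0)" if "k < N" for k
      using \<open>T = S \<or> T = transpose_mat S\<close> S j that car by (auto simp: diagonal_mat_def)
    have "(X *\<^sub>v col T j) $ i = (\<Sum>k\<in>{0..<N}. X $$ (i, k) * T $$ (k, j))"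
      using i j that by (auto simp: scalar_prod_def intro!: sum.cong)
    also have "\<dots> = (\<Sum>k\<in>{0..<N}. if k = j then X $$ (i, j) * S $$ (j, j) else 0)"
      by (rule sum.cong) (auto simp: T)
    finally show "(X *\<^sub>v col T j) $ i = (S $$ (j, j) \<cdot>\<^sub>v col X j) $ i"
      using i j that by simp
  qed (use that in simp)
  have "A * V = U * S * (transpose_mat V * V)"
    unfolding A using car by (intro assoc_mult_mat[of _ N N _ N _ N]) auto
  hence AV: "A * V = U * S" using car by (simp add: VV)
  have "col (A * V) j = A *\<^sub>v col V j" using car j by (intro col_mult2[of _ N N _ N]) auto
  moreover have "col (U * S) j = U *\<^sub>v col S j" using car j by (intro col_mult2[of _ N N _ N]) auto
  ultimately show "A *\<^sub>v col V j = S $$ (j, j) \<cdot>\<^sub>v col U j"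
    using scaled[of U S] car AV by simp
  have "transpose_mat A = V * (transpose_mat S * transpose_mat U)"
    unfolding A using car
    by (simp add: transpose_mult[of _ N N _ N])
  hence "transpose_mat A * U = V * transpose_mat S * (transpose_mat U * U)"
    using car by (simp add: assoc_mult_mat[of _ N N _ N _ N])
  hence AU: "transpose_mat A * U = V * transpose_mat S" using car by (simp add: UU)
  have "col (transpose_mat A * U) j = transpose_mat A *\<^sub>v col U j"
    using car j by (intro col_mult2[of _ N N _ N]) auto
  moreover have "col (V * transpose_mat S) j = V *\<^sub>v col (transpose_mat S) j"
    using car j by (intro col_mult2[of _ N N _ N]) auto
  ultimately show "transpose_mat A *\<^sub>v col U j = S $$ (j, j) \<cdot>\<^sub>v col V j"
    using scaled[of V "transpose_mat S"] car AU by simp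
  have unit: "(\<Sum>i<N. (col X j $ i)\<^sup>2) = 1" if "X \<in> carrier_mat N N" "transpose_mat X * X = 1\<^sub>m N" for X :: "real mat"
  proof -
    have "1 = (transpose_mat X * X) $$ (j, j)" using that j by simp
    also have "\<dots> = (\<Sum>i\<in>{0..<N}. (col X j $ i)\<^sup>2)"
      using that(1) j by (simp add: scalar_prod_def power2_eq_square)
    finally show ?thesis by (simp add: lessThan_atLeast0)
  qed
  show "(\<Sum>i<N. (col U j $ i)\<^sup>2) = 1" "(\<Sum>i<N. (col V j $ i)\<^sup>2) = 1"
    using unit car UU VV by auto
qed

text \<open>The singular value is positive because \<open>1 - z\<close> is invertible as a power series, and it is less than
\<open>2\<^sup>r\<close> because one difference increases the energy by a factor less than \<open>4\<close>.\<close>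

lemma svd_singular_pair:
  assumes svd: "is_svd N (diff_mat N ^\<^sub>m r) U S V" and r: "2 \<le> r" and j: "j < N"
  shows "singular_pair N r (root r (S $$ (j, j))) (\<lambda>i. col V j $ i) (\<lambda>i. col U j $ i)"
proof -
  let ?v = "\<lambda>i. col V j $ i" and ?u = "\<lambda>i. col U j $ i" and ?s = "S $$ (j, j)"
  let ?P = "[:1, -1:] :: complex poly"
  note sv = svd_vectors[OF svd j]
  have car: "U \<in> carrier_mat N N" "V \<in> carrier_mat N N" and s0: "0 \<le> ?s"
    using svd j by (auto simp: is_svd_def)
  have cv: "col V j \<in> carrier_vec N" "col U j \<in> carrier_vec N" using car by auto
  have fw: "coeff (?P ^ r * gen_poly ?v N) i = of_real (?s * ?u i)" if "i < N" for i
  proof -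
    have "coeff (?P ^ r * gen_poly ?v N) i = of_real ((diff_mat N ^\<^sub>m r *\<^sub>v col V j) $ i)"
      by (rule coeff_diff_mat_power[OF cv(1) _ that]) (simp add: coeff_gen_poly)
    thus ?thesis unfolding sv(1) using car that by simp
  qed
  have bw: "coeff (?P ^ r * gen_poly (reversed N ?u) N) i = of_real (?s * reversed N ?v i)" if "i < N" for i
  proof -
    have "coeff (?P ^ r * gen_poly (reversed N ?u) N) i
        = of_real ((transpose_mat (diff_mat N ^\<^sub>m r) *\<^sub>v col U j) $ (N - Suc i))"
      by (rule coeff_diff_mat_power_transpose[OF cv(2) _ that]) (simp add: coeff_gen_poly reversed_def)
    thus ?thesis unfolding sv(2) using car that by (simp add: reversed_def)
  qed
  have nsq: "(norm (complex_of_real x))\<^sup>2 = x\<^sup>2" for x by simp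
  have ev: "energy N (gen_poly ?v N) = 1"
    unfolding energy_def using sv(4) by (simp add: coeff_gen_poly)
  have "energy N (?P ^ r * gen_poly ?v N) = (\<Sum>i<N. (?s * ?u i)\<^sup>2)"
    unfolding energy_def by (rule sum.cong) (simp_all only: fw nsq lessThan_iff)
  also have "\<dots> = ?s\<^sup>2 * (\<Sum>i<N. (?u i)\<^sup>2)"
    by (simp only: power_mult_distrib sum_distrib_left)
  finally have "energy N (?P ^ r * gen_poly ?v N) = ?s\<^sup>2" unfolding sv(3) by simp
  moreover have "energy N (?P ^ r * gen_poly ?v N) < 4 ^ r * energy N (gen_poly ?v N)"
    by (rule energy_linear_power_less) (use r ev in auto)
  moreover have "((2::real) ^ r)\<^sup>2 = (2\<^sup>2) ^ r"
    by (simp only: power_mult[symmetric] mult.commute)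
  ultimately have "?s\<^sup>2 < (2 ^ r)\<^sup>2" unfolding ev by simp
  hence s2: "?s < 2 ^ r" by (rule power2_less_imp_less) simp
  have spos: "0 < ?s"
  proof (rule ccontr)
    assume "\<not> 0 < ?s"
    hence "?s = 0" using s0 by simp
    hence "coeff (?P ^ r * gen_poly ?v N) i = 0" if "i < N" for i using fw[OF that] by simp
    hence "coeff (gen_poly ?v N) i = 0" if "i < N" for i
      using linear_power_coeffs_zero[of N r "gen_poly ?v N" i] that by blast
    hence "energy N (gen_poly ?v N) = 0" by (simp add: energy_def)
    thus False using ev by simp
  qed
  have rs: "root r ?s ^ r = ?s" using r s0 by (simp add: real_root_pow_pos2)
  show ?thesis
  proof
    show "0 < root r ?s" using spos r by simp
    have "root r ?s < root r (2 ^ r)" using s2 r by simp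
    thus "root r ?s < 2" using r by (simp add: real_root_power_cancel)
  qed (use j r fw bw sv(3,4) in \<open>simp_all add: rs\<close>)
qed

lemma bound_const:
  assumes "2 \<le> r"
  shows "9 + 10 * evanescent_const r \<le> (20 * real r) ^ (6 * r)"
proof -
  define x where "x = real r"
  have x: "2 \<le> x" using assms by (simp add: x_def)
  have ev: "evanescent_const r = 16 * x\<^sup>2 * (6272 ^ r * x ^ (3 * r))"
  proof -
    have "evanescent_const r = 2 * x * 7 ^ r * ((16 * x) ^ r * (2 * x) ^ r * (2 * 7 ^ r * ((4 * x) ^ r * (4 * x))))"
      by (simp add: evanescent_const_def root_const_def state_const_def x_def)
    also have "\<dots> = 16 * x\<^sup>2 * ((7 ^ r * 16 ^ r * 2 ^ r * 7 ^ r * 4 ^ r) * (x ^ r * x ^ r * x ^ r))"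
      by (simp add: power_mult_distrib power2_eq_square mult_ac)
    also have "7 ^ r * 16 ^ r * 2 ^ r * 7 ^ r * 4 ^ r = (6272::real) ^ r"
      by (simp add: power_mult_distrib[symmetric])
    also have "x ^ r * x ^ r * x ^ r = x ^ (3 * r)"
    proof -
      have "3 * r = r + r + r" by simp
      thus ?thesis by (simp only: power_add)
    qed
    finally show ?thesis .
  qed
  have "1 \<le> x\<^sup>2 * (6272 ^ r * x ^ (3 * r))"
  proof -
    have "1 * (1 * 1) \<le> x\<^sup>2 * (6272 ^ r * x ^ (3 * r))"
      using x by (intro mult_mono one_le_power mult_nonneg_nonneg) auto
    thus ?thesis by simp
  qed
  hence "9 + 10 * evanescent_const r \<le> 169 * (x\<^sup>2 * (6272 ^ r * x ^ (3 * r)))"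
    unfolding ev mult.assoc by linarith
  also have "\<dots> \<le> 169 ^ r * (x ^ (3 * r) * (6272 ^ r * x ^ (3 * r)))"
  proof (intro mult_mono mult_right_mono)
    have "(169::real) ^ 1 \<le> 169 ^ r" using assms by (intro power_increasing) auto
    thus "(169::real) \<le> 169 ^ r" by simp
    show "x\<^sup>2 \<le> x ^ (3 * r)" using x assms by (intro power_increasing) auto
  qed (use x in auto)
  also have "\<dots> = (169 * 6272) ^ r * x ^ (6 * r)"
  proof -
    have "6 * r = 3 * r + 3 * r" by simp
    hence "x ^ (6 * r) = x ^ (3 * r) * x ^ (3 * r)" by (simp only: power_add)
    thus ?thesis by (simp only: power_mult_distrib mult_ac)
  qed
  also have "\<dots> \<le> (20 ^ 6) ^ r * x ^ (6 * r)"
    using x by (intro mult_right_mono power_mono) auto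
  also have "\<dots> = (20 * x) ^ (6 * r)" by (simp only: power_mult_distrib power_mult)
  finally show ?thesis by (simp add: x_def)
qed

theorem theorem1p1:
  shows "\<exists>C C\<^sub>3 :: real. C > 0 \<and> C\<^sub>3 > 0 \<and>
    (\<forall>(r :: nat) (N :: nat) (U :: real mat) (S :: real mat) (V :: real mat).
       r \<ge> 2 \<longrightarrow> N \<ge> 1 \<longrightarrow> real N \<ge> C\<^sub>3 ^ r \<longrightarrow>
       is_svd N (diff_mat N ^\<^sub>m r) U S V \<longrightarrow>
       Max (\<Union>j<N. {sup_norm_vec (col U j), sup_norm_vec (col V j)})
         \<le> (C * real r) ^ (6 * r) / sqrt (real N))"
proof (rule exI[of _ 20], rule exI[of _ 2], intro conjI allI impI)
  fix r N :: nat and U S V :: "real mat"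
  assume r: "r \<ge> 2" and N1: "N \<ge> 1" and N: "real N \<ge> 2 ^ r"
    and svd: "is_svd N (diff_mat N ^\<^sub>m r) U S V"
  let ?B = "(20 * real r) ^ (6 * r) / sqrt (real N)"
  have "(2::real) ^ 2 \<le> 2 ^ r" using r by (intro power_increasing) auto
  hence "(2::real) ^ 2 \<le> real N" using N by (rule order_trans)
  hence N4: "4 \<le> N" by simp
  have B0: "0 \<le> ?B" by simp
  have const: "(9 + 10 * evanescent_const r) / sqrt (real N) \<le> ?B"
    using bound_const[OF r] by (rule divide_right_mono) simp
  have car: "U \<in> carrier_mat N N" "V \<in> carrier_mat N N" using svd by (auto simp: is_svd_def)
  have entries: "\<bar>col U j $ i\<bar> \<le> ?B" "\<bar>col V j $ i\<bar> \<le> ?B" if j: "j < N" and i: "i < N" for i j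
  proof -
    have pair: "singular_pair N r (root r (S $$ (j, j))) (\<lambda>i. col V j $ i) (\<lambda>i. col U j $ i)"
      by (rule svd_singular_pair[OF svd r j])
    show "\<bar>col U j $ i\<bar> \<le> ?B"
      using singular_pair.singular_vector_bound[OF pair N4 i] const by linarith
    have "\<bar>reversed N (\<lambda>i. col V j $ i) (N - Suc i)\<bar> \<le> (9 + 10 * evanescent_const r) / sqrt (real N)"
      by (rule singular_pair.singular_vector_bound[OF singular_pair_reversed[OF pair] N4]) (use i in simp)
    thus "\<bar>col V j $ i\<bar> \<le> ?B" using const i by (simp add: reversed_def)
  qed
  have sup: "sup_norm_vec x \<le> ?B" if "\<And>i. i < N \<Longrightarrow> \<bar>x $ i\<bar> \<le> ?B" "dim_vec x = N" for x
    unfolding sup_norm_vec_def using that B0 by (subst Max_le_iff) auto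
  have "\<And>x. x \<in> (\<Union>j<N. {sup_norm_vec (col U j), sup_norm_vec (col V j)}) \<Longrightarrow> x \<le> ?B"
    using sup entries car by auto
  moreover have "(\<Union>j<N. {sup_norm_vec (col U j), sup_norm_vec (col V j)}) \<noteq> {}"
    using N1 by (auto intro!: exI[of _ 0])
  ultimately show "Max (\<Union>j<N. {sup_norm_vec (col U j), sup_norm_vec (col V j)}) \<le> ?B"
    by (subst Max_le_iff) auto
qed simp_all

end
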